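(* Let $\mathcal H$ be a real Hilbert space, $M\in\mathcal M(\mathcal H)$, $\beta\ge 0$, let $A:\mathcal H\to 2^{\mathcal H}$ be maximally monotone, let $C:\mathcal H\to\mathcal H$ be $\frac1\beta$-cocoercive with respect to $\|\cdot\|_M$, and assume that $\operatorname{zer}(A+C)=\{x\in\mathcal H: 0\in Ax+Cx\}$ is nonempty. Let $e\in[0,1]$, $\varepsilon>0$, $\gamma>0$, $\bar\beta\ge\beta$, and $\lambda_0=\big(1-\tfrac{\gamma\bar\beta}{4}\big)^e>0$ with $\varepsilon\le\gamma\bar\beta\le4-2\lambda_0-\varepsilon$ (so that $\gamma\bar\beta<4$). Let $\lambda_n=(1+n)^e\lambda_0$ for all $n\in\mathbb N$. Let $y_0\in\mathcal H$, $y_{-1}=p_{-1}=y_0$, and for all $n\in\mathbb N$ $$\begin{aligned} p_n&=(M+\gamma A)^{-1}(My_n-\gamma Cy_n),\\ y_{n+1}&=y_n+\Big(\tfrac{\lambda_0\lambda_n}{\lambda_{n+1}}+\tfrac{\lambda_{n+1}-\lambda_0}{\lambda_{n+1}}\,\tfrac{4-\gamma\bar\beta-2\lambda_0}{2}\Big)(p_n-y_n)+\tfrac{\lambda_n-\lambda_0}{\lambda_{n+1}}\Big((y_n-y_{n-1})+\tfrac{4-\gamma\bar\beta}{2}(y_{n-1}-p_{n-1})\Big). \end{aligned}$$ Then the following hold: (i) if $e>0$, then for every $x^\star\in\operatorname{zer}(A+C)$ and all $n\in\mathbb N$ $$\Big\|\tfrac1\gamma(p_n-y_n)\Big\|_M^2\le\frac{2\|y_0-x^\star\|_M^2}{\gamma^2(4-\gamma\bar\beta-2\lambda_0)\lambda_0(1+n)^{2e}};$$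 (ii) if $\bar\beta>\beta$ and $e<1$, then $(\|p_n-y_n\|^2)_{n\in\mathbb N}$ is summable; (iii) if $e=0$, the algorithm reduces to forward--backward splitting, i.e. $y_{n+1}=p_n=(M+\gamma A)^{-1}(My_n-\gamma Cy_n)$ for all $n\in\mathbb N$, and $(p_n)_{n\in\mathbb N}$ converges weakly to a point of $\operatorname{zer}(A+C)$.
   Context: $\mathbb N=\{0,1,2,\dots\}$. $\mathcal M(\mathcal H)$ is the set of bounded linear, self-adjoint, strongly positive operators on $\mathcal H$; for $M\in\mathcal M(\mathcal H)$, $\|x\|_M=\sqrt{\langle x,Mx\rangle}$ and $\|x\|_{M^{-1}}=\sqrt{\langle x,M^{-1}x\rangle}$. $C$ is $\frac1\beta$-cocoercive ($\beta\ge0$) w.r.t. $\|\cdot\|_M$ if $\beta\langle Cx-Cy,x-y\rangle\ge\|Cx-Cy\|_{M^{-1}}^2$ for all $x,y\in\mathcal H$. *)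

theory Defs
  imports "HOL-Analysis.Analysis"
begin

text \<open>
  Set-valued operators on a real Hilbert space are functions of type \<open>'a \<Rightarrow> 'a set\<close>.
  The ambient space is any type of class \<open>real_inner\<close> and \<open>complete_space\<close>.
\<close>

definition strongly_positive_operator :: "('a::real_inner \<Rightarrow> 'a) \<Rightarrow> bool" where
  "strongly_positive_operator M \<longleftrightarrow>
     bounded_linear M \<and>
     (\<forall>x y. inner (M x) y = inner x (M y)) \<and>
     (\<exists>c>0. \<forall>x. inner x (M x) \<ge> c * (norm x)\<^sup>2)"

definition norm_wrt :: "('a::real_inner \<Rightarrow> 'a) \<Rightarrow> 'a \<Rightarrow> real" where
  "norm_wrt M x = sqrt (inner x (M x))"

text \<open>
  \<open>cocoercive_wrt M \<beta> C\<close> says that \<open>C\<close> is \<open>1/\<beta>\<close>-cocoercive with respect to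
  \<open>norm_wrt M\<close>. Stated without division, so that \<open>\<beta> = 0\<close> is meaningful (and forces \<open>C\<close>
  to be constant). On a Hilbert space a strongly positive operator is bijective, so there
  \<open>inv M\<close> is its genuine inverse.
\<close>

definition cocoercive_wrt :: "('a::real_inner \<Rightarrow> 'a) \<Rightarrow> real \<Rightarrow> ('a \<Rightarrow> 'a) \<Rightarrow> bool" where
  "cocoercive_wrt M \<beta> C \<longleftrightarrow>
     (\<forall>x y. \<beta> * inner (C x - C y) (x - y) \<ge> (norm_wrt (inv M) (C x - C y))\<^sup>2)"

definition monotone_operator :: "('a::real_inner \<Rightarrow> 'a set) \<Rightarrow> bool" where
  "monotone_operator A \<longleftrightarrow>
     (\<forall>x y. \<forall>u\<in>A x. \<forall>v\<in>A y. inner (u - v) (x - y) \<ge> 0)"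

definition maximally_monotone :: "('a::real_inner \<Rightarrow> 'a set) \<Rightarrow> bool" where
  "maximally_monotone A \<longleftrightarrow>
     monotone_operator A \<and>
     (\<forall>B. monotone_operator B \<and> (\<forall>x. A x \<subseteq> B x) \<longrightarrow> B = A)"

definition scale_operator :: "real \<Rightarrow> ('a::real_vector \<Rightarrow> 'a set) \<Rightarrow> 'a \<Rightarrow> 'a set" where
  "scale_operator \<gamma> A x = (\<lambda>u. \<gamma> *\<^sub>R u) ` A x"

definition add_operator ::
    "('a::real_vector \<Rightarrow> 'a) \<Rightarrow> ('a \<Rightarrow> 'a set) \<Rightarrow> 'a \<Rightarrow> 'a set" where
  "add_operator F A x = (\<lambda>u. F x + u) ` A x"

definition inverse_operator :: "('a \<Rightarrow> 'b set) \<Rightarrow> 'b \<Rightarrow> 'a set" where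
  "inverse_operator T z = {x. z \<in> T x}"

definition zeros :: "('a::real_vector \<Rightarrow> 'a set) \<Rightarrow> 'a set" where
  "zeros T = {x. 0 \<in> T x}"

text \<open>
  The map \<open>(M + \<gamma>A)\<^sup>-\<^sup>1\<close> as a single-valued function. For \<open>M\<close> strongly positive,
  \<open>A\<close> maximally monotone and \<open>\<gamma> > 0\<close> on a Hilbert space, every value of the set-valued
  inverse is a singleton (Minty), so \<open>the_elem\<close> picks its only element.
\<close>

definition resolvent_wrt ::
    "('a::real_vector \<Rightarrow> 'a) \<Rightarrow> real \<Rightarrow> ('a \<Rightarrow> 'a set) \<Rightarrow> 'a \<Rightarrow> 'a" where
  "resolvent_wrt M \<gamma> A z =
     the_elem (inverse_operator (add_operator M (scale_operator \<gamma> A)) z)"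

definition weakly_converges :: "(nat \<Rightarrow> 'a::real_inner) \<Rightarrow> 'a \<Rightarrow> bool" where
  "weakly_converges x l \<longleftrightarrow> (\<forall>u. (\<lambda>n. inner (x n) u) \<longlonglongrightarrow> inner l u)"

end

theory Submission imports Defs begin

text \<open>
  Let \<open>G y = y - p(y)\<close> be the residual of one forward-backward step. Everything rests on the fact
  that, in the inner product of \<open>M\<close>, the residual is cocoercive with modulus
  \<open>\<kappa> = 1 - \<gamma> \<beta>' / 4\<close>, and that its zeros are the zeros of \<open>C + A\<close>
  (\<open>forward_backward_residual_cocoercive\<close>, \<open>forward_backward_residual_eq_0_iff\<close>). Hence
  \<open>R = I - 2 \<kappa> G\<close> is nonexpansive, and the momentum scheme is an anchored iteration of \<open>R\<close> in
  disguise: with \<open>\<theta>\<^sub>n = (1 + n)\<^sup>e\<close> and \<open>r\<^sub>n = 2 \<kappa> G y\<^sub>n\<close>,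
  the points \<open>z\<^sub>n = y\<^sub>n + (\<theta>\<^sub>n - 1) (y\<^sub>n - y\<^sub>n\<^sub>-\<^sub>1 + r\<^sub>n\<^sub>-\<^sub>1)\<close> satisfy
  \<open>\<theta>\<^sub>n\<^sub>+\<^sub>1 y\<^sub>n\<^sub>+\<^sub>1 = z\<^sub>n\<^sub>+\<^sub>1 + (\<theta>\<^sub>n\<^sub>+\<^sub>1 - 1) R y\<^sub>n\<close> and
  \<open>z\<^sub>n\<^sub>+\<^sub>1 = z\<^sub>n - \<delta>\<^sub>n \<mu> r\<^sub>n\<close>, where \<open>\<delta>\<^sub>n = 1 + \<theta>\<^sub>n - \<theta>\<^sub>n\<^sub>+\<^sub>1\<close> and
  \<open>\<mu> = \<lambda>\<^sub>0 / (2 \<kappa>) < 1\<close>. For \<open>e = 1\<close> the anchor \<open>z\<^sub>n\<close> does not move and this is Halpern's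
  iteration; for \<open>e = 0\<close> the iterate is the anchor itself and this is plain forward-backward
  splitting.

  Measured from a zero, an energy that adds a multiple of \<open>\<theta>\<^sub>n (\<theta>\<^sub>n - 1) \<parallel>r\<^sub>n\<parallel>\<^sup>2\<close> and a cross term to
  \<open>\<parallel>z\<^sub>n - x\<parallel>\<^sup>2\<close> decreases along the iteration (\<open>anchored_energy_decrease\<close>) and
  dominates \<open>\<mu> (1 - \<mu>) \<theta>\<^sub>n\<^sup>2 \<parallel>r\<^sub>n\<parallel>\<^sup>2\<close> (\<open>anchored_energy_ge\<close>), which is the rate. The amount by which it
  decreases is at least a multiple of \<open>\<delta>\<^sub>n \<parallel>r\<^sub>n\<parallel>\<^sup>2\<close>, and \<open>\<delta>\<^sub>n \<ge> 1 - e\<close>, so for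
  \<open>e < 1\<close> the residuals are square summable. For \<open>e = 0\<close> the residuals therefore tend to \<open>0\<close>, and
  the iteration of the nonexpansive map \<open>I - G\<close> converges weakly by Opial's theorem
  (\<open>opial_picard\<close>).

  The values of the resolvent are meaningful by Minty's theorem (\<open>minty_graph\<close>). This theorem, the
  surjectivity of \<open>M\<close> and the asymptotic centers behind Opial's theorem are all obtained from one
  existence result, the minimization of a strongly convex function (\<open>minimizer_over_epigraph\<close>).
\<close>

section \<open>The inner product of a strongly positive operator\<close>

definition inner_wrt :: "('a::real_inner \<Rightarrow> 'a) \<Rightarrow> 'a \<Rightarrow> 'a \<Rightarrow> real" where
  "inner_wrt M x y = inner x (M y)"

lemma norm_wrt_square:
  assumes "strongly_positive_operator M"
  shows "(norm_wrt M x)\<^sup>2 = inner_wrt M x x"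
proof -
  obtain c where "c > 0" "c * (norm x)\<^sup>2 \<le> inner x (M x)"
    using assms unfolding strongly_positive_operator_def by blast
  then have "0 \<le> inner x (M x)"
    by (smt (verit) mult_nonneg_nonneg zero_le_power2)
  then show ?thesis by (simp add: norm_wrt_def inner_wrt_def)
qed

context
  fixes M :: "'a::real_inner \<Rightarrow> 'a"
  assumes M: "strongly_positive_operator M"
begin

lemma strongly_positive_linear: "linear M"
  using M by (simp add: strongly_positive_operator_def bounded_linear.linear)

lemma inner_wrt_commute: "inner_wrt M x y = inner_wrt M y x"
  using M by (metis inner_wrt_def inner_commute strongly_positive_operator_def)

lemma inner_wrt_simps:
  "inner_wrt M (x + y) z = inner_wrt M x z + inner_wrt M y z"
  "inner_wrt M z (x + y) = inner_wrt M z x + inner_wrt M z y"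
  "inner_wrt M (x - y) z = inner_wrt M x z - inner_wrt M y z"
  "inner_wrt M z (x - y) = inner_wrt M z x - inner_wrt M z y"
  "inner_wrt M (a *\<^sub>R x) z = a * inner_wrt M x z"
  "inner_wrt M z (a *\<^sub>R x) = a * inner_wrt M z x"
  "inner_wrt M (- x) z = - inner_wrt M x z"
  "inner_wrt M z (- x) = - inner_wrt M z x"
  "inner_wrt M 0 z = 0" "inner_wrt M z 0 = 0"
  using strongly_positive_linear
  by (simp_all add: inner_wrt_def inner_simps linear_add linear_diff linear_scale linear_neg
      linear_0)

lemma inner_wrt_ge: "\<exists>c>0. \<forall>x. c * (norm x)\<^sup>2 \<le> inner_wrt M x x"
  using M by (auto simp: inner_wrt_def strongly_positive_operator_def)

lemma inner_wrt_nonneg: "0 \<le> inner_wrt M x x"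
  using norm_wrt_square[OF M] by (metis zero_le_power2)

lemma inner_wrt_eq_0: "inner_wrt M x x \<le> 0 \<Longrightarrow> x = 0"
proof -
  assume le: "inner_wrt M x x \<le> 0"
  obtain c where "c > 0" "c * (norm x)\<^sup>2 \<le> inner_wrt M x x" using inner_wrt_ge by blast
  with le have "c * (norm x)\<^sup>2 \<le> 0" by linarith
  with \<open>c > 0\<close> show "x = 0" by (simp add: mult_le_0_iff)
qed

lemma tendsto_inner_wrt:
  assumes "(f \<longlongrightarrow> a) F" "(g \<longlongrightarrow> b) F"
  shows "((\<lambda>x. inner_wrt M (f x) (g x)) \<longlongrightarrow> inner_wrt M a b) F"
  unfolding inner_wrt_def
  using M assms by (simp add: tendsto_inner bounded_linear.tendsto strongly_positive_operator_def)

lemma inner_wrt_bound: "\<exists>B>0. \<forall>x y. \<bar>inner_wrt M x y\<bar> \<le> B * norm x * norm y"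
proof -
  have "bounded_linear M" using M by (simp add: strongly_positive_operator_def)
  then obtain B where B: "B > 0" "\<And>x. norm (M x) \<le> norm x * B"
    using bounded_linear.pos_bounded by blast
  have "\<bar>inner_wrt M x y\<bar> \<le> B * norm x * norm y" for x y
  proof -
    have "\<bar>inner_wrt M x y\<bar> \<le> norm x * norm (M y)"
      by (simp add: inner_wrt_def Cauchy_Schwarz_ineq2)
    also have "\<dots> \<le> norm x * (norm y * B)"
      using B(2) by (intro mult_left_mono) auto
    finally show ?thesis by (simp add: mult_ac)
  qed
  with B(1) show ?thesis by blast
qed

end

section \<open>Minimization of strongly convex functions\<close>

text \<open>
  A minimizing sequence is Cauchy, because by the parallelogram identity the midpoint of two nearly
  optimal points would be better than optimal if they were far apart. The convex part of the
  objective enters through its epigraph \<open>K\<close>, which expresses infinite values and suprema by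
  inequalities between reals and lower semicontinuity by closedness of \<open>K\<close>. The minimizer comes with the
  quadratic growth of the objective around it, which replaces optimality conditions in all
  applications below.
\<close>

lemma minimizer_over_epigraph:
  fixes N :: "'b::{real_inner,complete_space} \<Rightarrow> 'b" and K :: "('b \<times> real) set"
  assumes N: "strongly_positive_operator N"
    and K: "closed K" "convex K" "K \<noteq> {}"
    and bdd: "\<And>x t. (x, t) \<in> K \<Longrightarrow> m \<le> t + inner_wrt N x x"
  obtains x0 t0 where "(x0, t0) \<in> K"
    "\<And>x t. (x, t) \<in> K \<Longrightarrow>
       t0 + inner_wrt N x0 x0 + inner_wrt N (x - x0) (x - x0) \<le> t + inner_wrt N x x"
proof -
  define \<phi> where "\<phi> = (\<lambda>(x, t). t + inner_wrt N x x)"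
  define I where "I = Inf (\<phi> ` K)"
  note simps = inner_wrt_simps[OF N] inner_wrt_commute[OF N]
  have below: "bdd_below (\<phi> ` K)"
    using bdd by (auto simp: \<phi>_def intro!: bdd_belowI2[where m = m])
  have I_le: "I \<le> \<phi> k" if "k \<in> K" for k
    unfolding I_def using below that by (intro cINF_lower)
  \<comment> \<open>Strong convexity along a segment: the quadratic part loses exactly the last term.\<close>
  have seg: "(1 - s) * \<phi> (x, t) + s * \<phi> (x', t') - s * (1 - s) * inner_wrt N (x - x') (x - x')
      \<ge> I" if "(x, t) \<in> K" "(x', t') \<in> K" "0 \<le> s" "s \<le> 1" for x t x' t' s
  proof -
    have "(1 - s) *\<^sub>R (x, t) + s *\<^sub>R (x', t') \<in> K"
      using K(2) that by (intro convexD) auto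
    then have "I \<le> \<phi> ((1 - s) *\<^sub>R (x, t) + s *\<^sub>R (x', t'))" by (rule I_le)
    also have "\<dots> = (1 - s) * \<phi> (x, t) + s * \<phi> (x', t')
        - s * (1 - s) * inner_wrt N (x - x') (x - x')"
      by (simp add: \<phi>_def simps algebra_simps)
    finally show ?thesis .
  qed
  have "\<exists>k\<in>K. \<phi> k < I + 1 / real (Suc n)" for n
  proof -
    have "Inf (\<phi> ` K) < I + 1 / real (Suc n)" by (simp add: I_def)
    then show ?thesis using cInf_lessD[of "\<phi> ` K"] K(3) by blast
  qed
  then obtain k where k: "\<And>n. k n \<in> K" "\<And>n. \<phi> (k n) < I + 1 / real (Suc n)" by metis
  define x t where "x = (\<lambda>n. fst (k n))" and "t = (\<lambda>n. snd (k n))"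
  have kxt: "k n = (x n, t n)" for n by (simp add: x_def t_def)
  obtain c where c: "c > 0" "\<And>x. c * (norm x)\<^sup>2 \<le> inner_wrt N x x"
    using inner_wrt_ge[OF N] by blast
  have dist: "c * (norm (x i - x j))\<^sup>2 \<le> 2 / real (Suc i) + 2 / real (Suc j)" for i j
  proof -
    have "I \<le> (1 - 1/2) * \<phi> (x i, t i) + 1/2 * \<phi> (x j, t j)
        - 1/2 * (1 - 1/2) * inner_wrt N (x i - x j) (x i - x j)"
      using k(1) by (intro seg) (auto simp flip: kxt)
    then show ?thesis using k(2)[of i] k(2)[of j] c(2)[of "x i - x j"] unfolding kxt
      by (simp del: of_nat_Suc)
  qed
  have "Cauchy x"
  proof (rule metric_CauchyI)
    fix \<epsilon> :: real assume "\<epsilon> > 0"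
    then obtain n where n: "4 / (c * \<epsilon>\<^sup>2) < real n"
      using reals_Archimedean2 by blast
    have "dist (x i) (x j) < \<epsilon>" if "i \<ge> n" "j \<ge> n" for i j
    proof -
      have "n > 0" using n c(1) by (intro gr0I) (auto simp: divide_less_0_iff mult_less_0_iff)
      have "2 / real (Suc i) \<le> 2 / real n" "2 / real (Suc j) \<le> 2 / real n"
        using that \<open>n > 0\<close> by (auto intro!: divide_left_mono)
      then have "c * (norm (x i - x j))\<^sup>2 \<le> 4 / real n" using dist[of i j] by simp
      also have "\<dots> < c * \<epsilon>\<^sup>2"
        using n c(1) \<open>\<epsilon> > 0\<close> \<open>n > 0\<close> by (simp add: divide_less_eq mult.commute)
      finally have "(norm (x i - x j))\<^sup>2 < \<epsilon>\<^sup>2" using c(1) by simp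
      then show ?thesis using \<open>\<epsilon> > 0\<close> by (simp add: dist_norm power2_less_imp_less)
    qed
    then show "\<exists>n. \<forall>i\<ge>n. \<forall>j\<ge>n. dist (x i) (x j) < \<epsilon>" by blast
  qed
  then obtain x0 where x0: "x \<longlonglongrightarrow> x0"
    by (auto simp: Cauchy_convergent_iff convergent_def)
  have "(\<lambda>n. \<phi> (k n)) \<longlonglongrightarrow> I"
  proof (rule tendsto_sandwich[where f = "\<lambda>_. I"])
    show "(\<lambda>n. I + 1 / real (Suc n)) \<longlonglongrightarrow> I"
      using tendsto_add[OF tendsto_const[of I] LIMSEQ_inverse_real_of_nat]
      by (simp add: inverse_eq_divide)
    show "\<forall>\<^sub>F n in sequentially. \<phi> (k n) \<le> I + 1 / real (Suc n)"
      using k(2) by (simp add: less_imp_le del: of_nat_Suc)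
    show "\<forall>\<^sub>F n in sequentially. I \<le> \<phi> (k n)" using I_le k(1) by simp
  qed simp
  then have "(\<lambda>n. \<phi> (k n) - inner_wrt N (x n) (x n)) \<longlonglongrightarrow> I - inner_wrt N x0 x0"
    using x0 by (intro tendsto_diff tendsto_inner_wrt[OF N])
  then have t: "t \<longlonglongrightarrow> I - inner_wrt N x0 x0" by (simp add: kxt \<phi>_def)
  define t0 where "t0 = I - inner_wrt N x0 x0"
  have "k \<longlonglongrightarrow> (x0, t0)"
    using tendsto_Pair[OF x0 t] by (simp add: t0_def flip: kxt)
  then have in_K: "(x0, t0) \<in> K"
    using K(1) k(1) closed_sequentially by blast
  \<comment> \<open>Quadratic growth: divide the segment inequality from \<open>x0\<close> by \<open>s\<close> and let \<open>s\<close> tend to \<open>0\<close>.\<close>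
  moreover have "t0 + inner_wrt N x0 x0 + inner_wrt N (x - x0) (x - x0) \<le> t + inner_wrt N x x"
    if xt: "(x, t) \<in> K" for x t
  proof -
    define D where "D = inner_wrt N (x0 - x) (x0 - x)"
    have "(1 - s) * D \<le> \<phi> (x, t) - I" if "0 < s" "s < 1" for s
    proof -
      have "I \<le> (1 - s) * \<phi> (x0, t0) + s * \<phi> (x, t) - s * (1 - s) * D"
        using seg[OF in_K xt, of s] that by (simp add: D_def)
      then have "s * ((1 - s) * D) \<le> s * (\<phi> (x, t) - I)"
        by (simp add: t0_def \<phi>_def algebra_simps)
      then show ?thesis using that(1) by simp
    qed
    moreover have "((\<lambda>s. (1 - s) * D) \<longlongrightarrow> (1 - 0) * D) (at_right 0)"
      by (intro tendsto_intros)
    moreover have "eventually (\<lambda>s::real. 0 < s \<and> s < 1) (at_right 0)"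
      using eventually_at_right_real[of 0 "1::real"] by simp
    ultimately have "(1 - 0) * D \<le> \<phi> (x, t) - I"
      by (intro tendsto_upperbound[where F = "at_right (0::real)"])
         (auto elim: eventually_mono)
    moreover have "D = inner_wrt N (x - x0) (x - x0)"
      by (simp add: D_def simps algebra_simps)
    ultimately show ?thesis by (simp add: t0_def \<phi>_def)
  qed
  ultimately show ?thesis by (rule that)
qed

section \<open>Inverses of strongly positive operators\<close>

text \<open>
  Surjectivity is the Lax-Milgram argument: the minimizer of \<open>\<langle>x, M x\<rangle> - 2 \<langle>b, x\<rangle>\<close> solves
  \<open>M x = b\<close>.
\<close>

lemma strongly_positive_bij:
  fixes M :: "'a::{real_inner,complete_space} \<Rightarrow> 'a"
  assumes M: "strongly_positive_operator M"
  shows "bij M"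
proof (rule bijI)
  note simps = inner_wrt_simps[OF M] inner_wrt_commute[OF M]
  show "inj M"
  proof (rule injI)
    fix x y assume "M x = M y"
    then have "inner_wrt M (x - y) (x - y) = 0"
      using linear_diff[OF strongly_positive_linear[OF M], of x y] by (simp add: inner_wrt_def)
    then show "x = y" using inner_wrt_eq_0[OF M, of "x - y"] by simp
  qed
  have "\<exists>x. M x = b" for b
  proof -
    define K where "K = {(x, t). - 2 * inner b x \<le> t}"
    have "K = {k. - 2 * inner b (fst k) \<le> snd k}" by (auto simp: K_def)
    then have "closed K" by (auto intro!: closed_Collect_le continuous_intros)
    moreover have "convex K"
    proof (rule convexI)
      fix k k' and u v :: real
      assume "k \<in> K" "k' \<in> K" "0 \<le> u" "0 \<le> v" "u + v = 1"
      then show "u *\<^sub>R k + v *\<^sub>R k' \<in> K"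
        using mult_left_mono[of "- 2 * inner b (fst k)" "snd k" u]
          mult_left_mono[of "- 2 * inner b (fst k')" "snd k'" v]
        by (auto simp: K_def inner_simps split: prod.splits)
    qed
    moreover have "(0, 0) \<in> K" by (simp add: K_def)
    moreover obtain c where c: "c > 0" "\<And>x. c * (norm x)\<^sup>2 \<le> inner_wrt M x x"
      using inner_wrt_ge[OF M] by blast
    have "- (norm b)\<^sup>2 / c \<le> t + inner_wrt M x x" if "(x, t) \<in> K" for x t
    proof -
      \<comment> \<open>Completing the square bounds the objective from below.\<close>
      have "0 \<le> (norm (c *\<^sub>R x - b))\<^sup>2 / c" using c(1) by simp
      also have "(norm (c *\<^sub>R x - b))\<^sup>2 = c\<^sup>2 * (norm x)\<^sup>2 - 2 * c * inner b x + (norm b)\<^sup>2"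
        unfolding power2_norm_eq_inner
        by (simp add: inner_simps inner_commute[of x b] power2_eq_square algebra_simps)
      also have "\<dots> / c = c * (norm x)\<^sup>2 - 2 * inner b x + (norm b)\<^sup>2 / c"
        using c(1) by (simp add: add_divide_distrib diff_divide_distrib power2_eq_square)
      finally show ?thesis using that c(2)[of x] by (simp add: K_def)
    qed
    ultimately obtain x0 t0 where x0: "(x0, t0) \<in> K"
      "\<And>x t. (x, t) \<in> K \<Longrightarrow>
         t0 + inner_wrt M x0 x0 + inner_wrt M (x - x0) (x - x0) \<le> t + inner_wrt M x x"
      using minimizer_over_epigraph[OF M, of K] by (metis empty_iff)
    have "0 \<le> inner (M x0 - b) h" for h
    proof -
      have "(x0 + h, - 2 * inner b (x0 + h)) \<in> K" by (simp add: K_def)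
      from x0(2)[OF this] x0(1) have "2 * inner b h \<le> 2 * inner_wrt M h x0"
        by (simp add: K_def simps inner_simps)
      then show ?thesis by (simp add: inner_wrt_def inner_simps inner_commute)
    qed
    from this[of "- (M x0 - b)"] have "inner (M x0 - b) (M x0 - b) \<le> 0"
      by (simp only: inner_minus_right)
    then have "M x0 = b" using inner_gt_zero_iff[of "M x0 - b"] by (simp add: not_less[symmetric])
    then show ?thesis ..
  qed
  then show "surj M" by (metis surjI)
qed

lemma strongly_positive_inv:
  fixes M :: "'a::{real_inner,complete_space} \<Rightarrow> 'a"
  assumes M: "strongly_positive_operator M"
  shows "strongly_positive_operator (inv M)"
proof -
  have lin: "linear M" by (rule strongly_positive_linear[OF M])
  have bij: "bij M" by (rule strongly_positive_bij[OF M])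
  have MM[simp]: "M (inv M x) = x" for x using bij by (simp add: bij_is_surj surj_f_inv_f)
  have eqI: "x = y" if "M x = M y" for x y using bij that by (simp add: bij_is_inj inj_eq)
  obtain c where c: "c > 0" "\<And>x. c * (norm x)\<^sup>2 \<le> inner x (M x)"
    using M by (auto simp: strongly_positive_operator_def)
  have adj: "inner (M x) y = inner x (M y)" for x y
    using M by (auto simp: strongly_positive_operator_def)
  have inv_bound: "norm (inv M u) \<le> norm u * (1 / c)" for u
  proof (cases "inv M u = 0")
    case False
    have "c * (norm (inv M u))\<^sup>2 \<le> inner (inv M u) u" using c(2)[of "inv M u"] by simp
    also have "\<dots> \<le> norm (inv M u) * norm u" by (rule norm_cauchy_schwarz)
    finally have "c * norm (inv M u) \<le> norm u" using False by (simp add: power2_eq_square)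
    then show ?thesis using c(1) by (simp add: field_simps)
  qed (use c(1) in simp)
  have "bounded_linear (inv M)"
  proof (rule bounded_linear_intro[where K = "1 / c"])
    show "inv M (x + y) = inv M x + inv M y" for x y
      by (rule eqI) (simp add: linear_add[OF lin])
    show "inv M (r *\<^sub>R x) = r *\<^sub>R inv M x" for r x
      by (rule eqI) (simp add: linear_scale[OF lin])
  qed (rule inv_bound)
  moreover have "inner (inv M x) y = inner x (inv M y)" for x y
    using adj[of "inv M x" "inv M y"] by simp
  moreover have "\<exists>c>0. \<forall>u. c * (norm u)\<^sup>2 \<le> inner u (inv M u)"
  proof -
    obtain B where B: "B > 0" "\<And>x. norm (M x) \<le> norm x * B"
      using M bounded_linear.pos_bounded unfolding strongly_positive_operator_def by blast
    have "c / B\<^sup>2 * (norm u)\<^sup>2 \<le> inner u (inv M u)" for u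
    proof -
      have "(norm u)\<^sup>2 \<le> (norm (inv M u) * B)\<^sup>2"
        using B(2)[of "inv M u"] by (intro power_mono) auto
      then have "c / B\<^sup>2 * (norm u)\<^sup>2 \<le> c / B\<^sup>2 * (norm (inv M u) * B)\<^sup>2"
        using c(1) by (intro mult_left_mono) auto
      also have "\<dots> = c * (norm (inv M u))\<^sup>2"
        using B(1) by (simp add: power_mult_distrib)
      also have "\<dots> \<le> inner u (inv M u)" using c(2)[of "inv M u"] by (simp add: inner_commute)
      finally show ?thesis .
    qed
    moreover have "c / B\<^sup>2 > 0" using B(1) c(1) by simp
    ultimately show ?thesis by blast
  qed
  ultimately show ?thesis unfolding strongly_positive_operator_def by blast
qed

section \<open>Minty's theorem\<close>

text \<open>
  Minty's theorem is proved by minimizing over pairs of a point and a dual vector; the dual vector is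
  measured by \<open>inv M\<close>.
\<close>

lemma strongly_positive_map_prod:
  fixes M :: "'a::real_inner \<Rightarrow> 'a" and N :: "'b::real_inner \<Rightarrow> 'b"
  assumes M: "strongly_positive_operator M" and N: "strongly_positive_operator N"
  shows "strongly_positive_operator (map_prod M N)"
proof -
  have "bounded_linear (\<lambda>z. (M (fst z), N (snd z)))"
    using M N by (intro bounded_linear_Pair bounded_linear_compose[OF _ bounded_linear_fst]
        bounded_linear_compose[OF _ bounded_linear_snd])
      (simp_all add: strongly_positive_operator_def)
  then have "bounded_linear (map_prod M N)" by (simp add: map_prod_def case_prod_unfold)
  moreover have "inner (map_prod M N z) z' = inner z (map_prod M N z')" for z z'
    using M N by (cases z; cases z') (simp add: strongly_positive_operator_def)
  moreover have "\<exists>c>0. \<forall>z. c * (norm z)\<^sup>2 \<le> inner z (map_prod M N z)"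
  proof -
    obtain c d where c: "c > 0" "\<And>x. c * (norm x)\<^sup>2 \<le> inner x (M x)"
      and d: "d > 0" "\<And>x. d * (norm x)\<^sup>2 \<le> inner x (N x)"
      using M N unfolding strongly_positive_operator_def by blast
    have "min c d * (norm z)\<^sup>2 \<le> inner z (map_prod M N z)" for z
    proof -
      obtain x u where z: "z = (x, u)" by (cases z)
      have "min c d * (norm x)\<^sup>2 \<le> c * (norm x)\<^sup>2" "min c d * (norm u)\<^sup>2 \<le> d * (norm u)\<^sup>2"
        by (simp_all add: mult_right_mono)
      then show ?thesis using c(2)[of x] d(2)[of u]
        by (simp add: z norm_Pair distrib_left)
    qed
    then show ?thesis using c(1) d(1) by (metis min_less_iff_conj)
  qed
  ultimately show ?thesis unfolding strongly_positive_operator_def by blast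
qed

text \<open>
  The proof minimizes
  \<open>2 F(x, u) + \<langle>x, M x\<rangle> + \<langle>u, M\<^sup>-\<^sup>1 u\<rangle>\<close>, where
  \<open>F(x, u) = sup {\<langle>x, b\<rangle> + \<langle>a, u\<rangle> - \<langle>a, b\<rangle> | (a, b) \<in> G}\<close> is the Fitzpatrick function of \<open>G\<close>.
  Maximality gives \<open>F(x, u) \<ge> \<langle>x, u\<rangle>\<close>, so the objective is at least
  \<open>\<langle>M x + u, M\<^sup>-\<^sup>1 (M x + u)\<rangle> \<ge> 0\<close>; monotonicity gives \<open>F(a, b) = \<langle>a, b\<rangle>\<close> on \<open>G\<close>. Comparing a
  minimizer \<open>(x0, u0)\<close> with the points of \<open>G\<close> shows that \<open>(- M\<^sup>-\<^sup>1 u0, - M x0)\<close> is monotonically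
  related to \<open>G\<close>, hence in \<open>G\<close>, and then that \<open>M x0 + u0 = 0\<close>. The theorem is stated
  for graphs so that it applies directly to the graph of \<open>\<gamma> A - z\<close>.
\<close>

theorem minty_graph:
  fixes M :: "'a::{real_inner,complete_space} \<Rightarrow> 'a" and G :: "('a \<times> 'a) set"
  assumes M: "strongly_positive_operator M"
    and mono: "\<And>a b a' b'. (a, b) \<in> G \<Longrightarrow> (a', b') \<in> G \<Longrightarrow> 0 \<le> inner (a - a') (b - b')"
    and maximal: "\<And>x u. (\<And>a b. (a, b) \<in> G \<Longrightarrow> 0 \<le> inner (x - a) (u - b)) \<Longrightarrow> (x, u) \<in> G"
  shows "\<exists>x. (x, - M x) \<in> G"
proof -
  define W where "W = inv M"
  have W: "strongly_positive_operator W"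
    unfolding W_def using M by (rule strongly_positive_inv)
  have bij: "bij M" by (rule strongly_positive_bij[OF M])
  have MW[simp]: "M (W x) = x" and WM[simp]: "W (M x) = x" for x
    using bij by (simp_all add: W_def bij_is_surj surj_f_inv_f bij_is_inj)
  have N: "strongly_positive_operator (map_prod M W)"
    by (rule strongly_positive_map_prod[OF M W])
  have ip_N: "inner_wrt (map_prod M W) (x, u) (x', u') = inner x (M x') + inner u (W u')"
    for x u x' u' by (simp add: inner_wrt_def)
  note Ms = inner_wrt_simps[OF M, unfolded inner_wrt_def]
  note Ws = inner_wrt_simps[OF W, unfolded inner_wrt_def]
  have adj: "inner (M x) y = inner x (M y)" "inner (W x) y = inner x (W y)" for x y
    using M W by (simp_all add: strongly_positive_operator_def)
  have W_sum: "inner (M x + u) (W (M x + u)) = inner x (M x) + 2 * inner x u + inner u (W u)"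
    for x u
    by (simp add: Ws inner_add adj(1) inner_commute[of u x])
  have W_nonneg: "0 \<le> inner u (W u)" for u
    using inner_wrt_nonneg[OF W] by (simp add: inner_wrt_def)

  \<comment> \<open>The epigraph of \<open>2 F\<close>.\<close>
  define K where "K = {(z, t). \<forall>(a, b) \<in> G.
    2 * (inner (fst z) b + inner a (snd z) - inner a b) \<le> t}"
  have K_iff: "((x, u), t) \<in> K \<longleftrightarrow>
      (\<forall>a b. (a, b) \<in> G \<longrightarrow> 2 * (inner x b + inner a u - inner a b) \<le> t)" for x u t
    by (auto simp: K_def)
  have graph_K: "((a, b), 2 * inner a b) \<in> K" if "(a, b) \<in> G" for a b
    using mono[OF that] by (fastforce simp: K_iff inner_simps inner_commute)
  have K_ge: "2 * inner x u \<le> t" if K: "((x, u), t) \<in> K" for x u t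
  proof (rule ccontr)
    assume "\<not> ?thesis"
    then have less: "0 < inner (x - a) (u - b)" if "(a, b) \<in> G" for a b
      using K[unfolded K_iff, rule_format, OF that] by (simp add: inner_simps)
    then have "(x, u) \<in> G" using less_imp_le by (intro maximal) blast
    from less[OF this] show False by simp
  qed
  have "K = (\<Inter>(a, b) \<in> G.
      {k. 2 * (inner (fst (fst k)) b + inner a (snd (fst k)) - inner a b) \<le> snd k})"
    by (auto simp: K_def)
  then have "closed K"
    by (auto intro!: closed_INT closed_Collect_le continuous_intros)
  moreover have "convex K"
  proof (rule convexI)
    fix k k' and r s :: real
    assume k: "k \<in> K" "k' \<in> K" and rs: "0 \<le> r" "0 \<le> s" "r + s = 1"
    obtain x u t x' u' t' where eq: "k = ((x, u), t)" "k' = ((x', u'), t')"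
      by (metis surj_pair)
    have "2 * (inner (r *\<^sub>R x + s *\<^sub>R x') b + inner a (r *\<^sub>R u + s *\<^sub>R u') - inner a b)
        \<le> r * t + s * t'" if "(a, b) \<in> G" for a b
    proof -
      have "r * (2 * (inner x b + inner a u - inner a b))
          + s * (2 * (inner x' b + inner a u' - inner a b)) \<le> r * t + s * t'"
        using k rs that by (intro add_mono mult_left_mono) (auto simp: eq K_iff)
      moreover have "inner a b = r * inner a b + s * inner a b"
        using rs(3) by (metis distrib_right mult_1)
      ultimately show ?thesis by (simp add: inner_simps algebra_simps)
    qed
    then show "r *\<^sub>R k + s *\<^sub>R k' \<in> K" by (simp add: eq K_iff)
  qed
  moreover have "K \<noteq> {}"
  proof -
    have "G \<noteq> {}" using maximal by (metis empty_iff)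
    then show ?thesis using graph_K by fastforce
  qed
  moreover have "0 \<le> t + inner_wrt (map_prod M W) z z" if "(z, t) \<in> K" for z t
  proof -
    obtain x u where z: "z = (x, u)" by (cases z)
    show ?thesis using K_ge[of x u t] that W_nonneg[of "M x + u"] W_sum[of x u]
      by (simp add: z ip_N)
  qed
  ultimately obtain z0 t0 where z0: "(z0, t0) \<in> K" and min: "\<And>z t. (z, t) \<in> K \<Longrightarrow>
      t0 + inner_wrt (map_prod M W) z0 z0 + inner_wrt (map_prod M W) (z - z0) (z - z0)
      \<le> t + inner_wrt (map_prod M W) z z"
    using minimizer_over_epigraph[OF N] by metis
  obtain x0 u0 where eq: "z0 = (x0, u0)" by (cases z0)
  define S where "S = inner (M x0 + u0) (W (M x0 + u0))"
  have key: "S \<le> inner (- W u0 - a) (- M x0 - b)" if "(a, b) \<in> G" for a b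
  proof -
    have "inner (a - x0) (M (a - x0)) = inner a (M a) - 2 * inner a (M x0) + inner x0 (M x0)"
      using adj(1)[of a x0] by (simp add: Ms inner_commute[of "M a" x0])
    moreover have "inner (b - u0) (W (b - u0)) = inner b (W b) - 2 * inner b (W u0) + inner u0 (W u0)"
      using adj(2)[of b u0] by (simp add: Ws inner_commute[of "W b" u0])
    moreover have "inner (- W u0 - a) (- M x0 - b)
        = inner x0 u0 + inner b (W u0) + inner a (M x0) + inner a b"
      using adj(2)[of u0 "M x0"]
      by (simp add: inner_diff inner_commute[of u0 x0] inner_commute[of b "W u0"])
    ultimately show ?thesis
      using min[OF graph_K[OF that]] K_ge[OF z0[unfolded eq]] W_sum[of x0 u0]
      by (simp add: S_def eq ip_N)
  qed
  have in_G: "(- W u0, - M x0) \<in> G"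
    using key W_nonneg[of "M x0 + u0"] by (intro maximal) (fastforce simp: S_def)
  have "M x0 + u0 = 0"
    using key[OF in_G] inner_wrt_eq_0[OF W, of "M x0 + u0"] by (simp add: S_def inner_wrt_def)
  then have "u0 = - M x0" by (simp add: eq_neg_iff_add_eq_0 add.commute)
  then have "W u0 = - x0"
    using linear_neg[OF strongly_positive_linear[OF W], of "M x0"] by simp
  with in_G show ?thesis by auto
qed

section \<open>Asymptotic centers and Opial's theorem\<close>

text \<open>
  The asymptotic center \<open>q\<close> of a bounded sequence minimizes
  \<open>v \<mapsto> limsup \<parallel>x\<^sub>n - v\<parallel>\<^sup>2\<close>; \<open>\<rho>\<close> is the minimal value. It takes the place of a weak cluster
  point in Opial's theorem. A filter takes the role of a
  subsequence, and the limit superior is expressed by its upper bounds.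
\<close>

lemma asymptotic_center:
  fixes M :: "'a::{real_inner,complete_space} \<Rightarrow> 'a"
  assumes M: "strongly_positive_operator M"
    and F: "F \<noteq> bot" and bounded: "\<And>n. norm (x n) \<le> B"
  shows "\<exists>q \<rho>. (\<forall>\<epsilon>>0. \<forall>\<^sub>F n in F. inner_wrt M (x n - q) (x n - q) \<le> \<rho> + \<epsilon>) \<and>
    (\<forall>v R. (\<forall>\<epsilon>>0. \<forall>\<^sub>F n in F. inner_wrt M (x n - v) (x n - v) \<le> R + \<epsilon>)
      \<longrightarrow> \<rho> + inner_wrt M (v - q) (v - q) \<le> R)"
proof -
  note simps = inner_wrt_simps[OF M]
  have sq: "inner_wrt M (x n - v) (x n - v) =
      inner_wrt M (x n) (x n) - 2 * inner_wrt M (x n) v + inner_wrt M v v" for n v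
    by (simp add: simps inner_wrt_commute[OF M, of v "x n"])
  obtain D where D: "D > 0" "\<And>x y. \<bar>inner_wrt M x y\<bar> \<le> D * norm x * norm y"
    using inner_wrt_bound[OF M] by blast
  have B: "0 \<le> B" using bounded[of undefined] norm_ge_zero order_trans by blast
  have D_bound: "\<bar>inner_wrt M (x n) v\<bar> \<le> D * B * norm v" for n v
    using D(2)[of "x n" v] D(1) bounded[of n]
    by (smt (verit, best) mult_left_mono mult_right_mono norm_ge_zero)
  define f where "f n v = inner_wrt M (x n) (x n) - 2 * inner_wrt M (x n) v" for n v
  \<comment> \<open>The epigraph of \<open>v \<mapsto> limsup (\<parallel>x n\<parallel>\<^sup>2 - 2 \<langle>x n, v\<rangle>)\<close>, a convex function that differs
    from the objective by \<open>\<parallel>v\<parallel>\<^sup>2\<close>.\<close>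
  define K where "K = {(v, t). \<forall>\<epsilon>>0. \<forall>\<^sub>F n in F. f n v \<le> t + \<epsilon>}"
  have "closed K" unfolding closed_sequential_limits
  proof (intro allI impI, elim conjE)
    fix k l assume k: "\<forall>m. k m \<in> K" and lim: "k \<longlonglongrightarrow> l"
    obtain v t where l: "l = (v, t)" by (cases l)
    show "l \<in> K" unfolding l K_def
    proof (clarsimp)
      fix \<epsilon> :: real assume "\<epsilon> > 0"
      have "(\<lambda>m. \<bar>snd (k m) - t\<bar> + 2 * (D * B * norm (fst (k m) - v)))
          \<longlonglongrightarrow> \<bar>snd l - t\<bar> + 2 * (D * B * norm (fst l - v))"
        by (intro tendsto_intros lim)
      then have "\<forall>\<^sub>F m in sequentially.
          \<bar>snd (k m) - t\<bar> + 2 * (D * B * norm (fst (k m) - v)) < \<epsilon> / 2"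
        by (rule order_tendstoD) (use \<open>\<epsilon> > 0\<close> in \<open>simp add: l\<close>)
      then obtain m where m: "\<bar>snd (k m) - t\<bar> + 2 * (D * B * norm (fst (k m) - v)) < \<epsilon> / 2"
        by (auto simp: eventually_sequentially)
      have "\<forall>\<^sub>F n in F. f n (fst (k m)) \<le> snd (k m) + \<epsilon> / 2"
        using k[rule_format, of m] \<open>\<epsilon> > 0\<close> by (auto simp: K_def)
      then show "\<forall>\<^sub>F n in F. f n v \<le> t + \<epsilon>"
      proof eventually_elim
        case (elim n)
        have "f n v = f n (fst (k m)) + 2 * inner_wrt M (x n) (fst (k m) - v)"
          by (simp add: f_def simps)
        with elim m D_bound[of n "fst (k m) - v"] show ?case by linarith
      qed
    qed
  qed
  moreover have "convex K"
  proof (rule convexI)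
    fix k k' and r s :: real
    assume k: "k \<in> K" "k' \<in> K" and rs: "0 \<le> r" "0 \<le> s" "r + s = 1"
    obtain v t v' t' where eq: "k = (v, t)" "k' = (v', t')" by (metis surj_pair)
    have "\<forall>\<^sub>F n in F. f n (r *\<^sub>R v + s *\<^sub>R v') \<le> r * t + s * t' + \<epsilon>" if "\<epsilon> > 0" for \<epsilon>
    proof -
      have "\<forall>\<^sub>F n in F. f n v \<le> t + \<epsilon> \<and> f n v' \<le> t' + \<epsilon>"
        using k \<open>\<epsilon> > 0\<close> by (auto simp: K_def eq intro: eventually_conj)
      then show ?thesis
      proof eventually_elim
        case (elim n)
        have split: "w = r * w + s * w" for w
          using rs(3) by (metis distrib_right mult_1)
        have "f n (r *\<^sub>R v + s *\<^sub>R v') = r * f n v + s * f n v'"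
          using split[of "inner_wrt M (x n) (x n)"] by (simp add: f_def simps algebra_simps)
        also have "\<dots> \<le> r * (t + \<epsilon>) + s * (t' + \<epsilon>)"
          using elim rs by (intro add_mono mult_left_mono) auto
        also have "\<dots> = r * t + s * t' + \<epsilon>"
          using split[of \<epsilon>] by (simp add: algebra_simps)
        finally show ?case .
      qed
    qed
    then show "r *\<^sub>R k + s *\<^sub>R k' \<in> K" by (simp add: eq K_def)
  qed
  moreover have "K \<noteq> {}"
  proof -
    have "f n 0 \<le> D * B * B + \<epsilon>" if "\<epsilon> > 0" for n \<epsilon>
    proof -
      have "D * B * norm (x n) \<le> D * B * B"
        using bounded[of n] D(1) B by (intro mult_left_mono) auto
      then show ?thesis using D_bound[of n "x n"] that by (simp add: f_def simps)
    qed
    then have "(0, D * B * B) \<in> K" by (auto simp: K_def)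
    then show ?thesis by blast
  qed
  moreover have "0 \<le> t + inner_wrt M v v" if "(v, t) \<in> K" for v t
  proof (rule field_le_epsilon)
    fix \<epsilon> :: real assume "\<epsilon> > 0"
    then have "\<forall>\<^sub>F n in F. f n v \<le> t + \<epsilon>" using that by (simp add: K_def)
    then obtain n where "f n v \<le> t + \<epsilon>" using eventually_happens'[OF F] by blast
    then show "0 \<le> t + inner_wrt M v v + \<epsilon>"
      using inner_wrt_nonneg[OF M, of "x n - v"] by (simp add: sq f_def)
  qed
  ultimately obtain q t where qt: "(q, t) \<in> K" and min: "\<And>v s. (v, s) \<in> K \<Longrightarrow>
      t + inner_wrt M q q + inner_wrt M (v - q) (v - q) \<le> s + inner_wrt M v v"
    using minimizer_over_epigraph[OF M] by metis
  show ?thesis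
  proof (intro exI[of _ q] exI[of _ "t + inner_wrt M q q"] conjI allI impI)
    show "\<forall>\<^sub>F n in F. inner_wrt M (x n - q) (x n - q) \<le> t + inner_wrt M q q + \<epsilon>"
      if "\<epsilon> > 0" for \<epsilon>
    proof -
      have "\<forall>\<^sub>F n in F. f n q \<le> t + \<epsilon>" using qt that by (simp add: K_def)
      then show ?thesis by eventually_elim (simp add: sq f_def)
    qed
    fix v R
    assume R: "\<forall>\<epsilon>>0. \<forall>\<^sub>F n in F. inner_wrt M (x n - v) (x n - v) \<le> R + \<epsilon>"
    have "\<forall>\<^sub>F n in F. f n v \<le> R - inner_wrt M v v + \<epsilon>" if "\<epsilon> > 0" for \<epsilon>
      using R[rule_format, OF that] by eventually_elim (simp add: sq f_def)
    then have "(v, R - inner_wrt M v v) \<in> K" by (simp add: K_def)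
    from min[OF this]
    show "t + inner_wrt M q q + inner_wrt M (v - q) (v - q) \<le> R" by simp
  qed
qed

text \<open>
  Along every proper filter finer than \<open>sequentially\<close> the asymptotic center is a fixed point, since applying \<open>T\<close> does
  not worsen it and centers are unique. The distances to a fixed point decrease, so their limit is the
  same along all such filters; hence all these centers coincide with one point \<open>q\<close>. If
  \<open>\<langle>y\<^sub>n - q, w\<rangle>\<close> stayed above some \<open>\<eta> > 0\<close> along a filter, then \<open>q + w\<close> would be closer to the
  sequence along that filter than the growth of the distance around its center \<open>q\<close> allows.
\<close>

theorem opial_picard:
  fixes M T :: "'a::{real_inner,complete_space} \<Rightarrow> 'a"
  assumes M: "strongly_positive_operator M"
    and nonexp: "\<And>u v. inner_wrt M (T u - T v) (T u - T v) \<le> inner_wrt M (u - v) (u - v)"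
    and fixed: "T f = f"
    and step: "\<And>n. y (Suc n) = T (y n)"
    and regular: "(\<lambda>n. y (Suc n) - y n) \<longlonglongrightarrow> 0"
  shows "\<exists>q. T q = q \<and> weakly_converges y q"
proof -
  note simps = inner_wrt_simps[OF M]
  obtain c where c: "c > 0" "\<And>x. c * (norm x)\<^sup>2 \<le> inner_wrt M x x"
    using inner_wrt_ge[OF M] by blast
  obtain D where D: "D > 0" "\<And>x y. \<bar>inner_wrt M x y\<bar> \<le> D * norm x * norm y"
    using inner_wrt_bound[OF M] by blast
  define h where "h v n = inner_wrt M (y n - v) (y n - v)" for v n
  have fejer: "decseq (h v)" if "T v = v" for v
    using nonexp[of "y _" v] that by (auto simp: h_def step intro!: decseq_SucI)
  define l where "l v = lim (h v)" for v
  have lim: "h v \<longlonglongrightarrow> l v" if "T v = v" for v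
    unfolding l_def
    using decseq_convergent[OF fejer[OF that], of 0] inner_wrt_nonneg[OF M]
    by (metis h_def convergent_LIMSEQ_iff convergent_def)

  define B where "B = sqrt (h f 0 / c) + norm f"
  have B: "norm (y n) \<le> B" for n
  proof -
    have "c * (norm (y n - f))\<^sup>2 \<le> h f n" using c(2) by (simp add: h_def)
    also have "\<dots> \<le> h f 0" using fejer[OF fixed] by (auto dest: decseqD)
    finally have "(norm (y n - f))\<^sup>2 \<le> h f 0 / c" using c(1) by (simp add: field_simps)
    then have "norm (y n - f) \<le> sqrt (h f 0 / c)" by (rule real_le_rsqrt)
    then show ?thesis unfolding B_def using norm_triangle_sub[of "y n" f] by linarith
  qed

  have center: "\<exists>q. T q = q \<and>
      (\<forall>\<epsilon>>0. \<forall>\<^sub>F n in F. h q n \<le> l q + \<epsilon>) \<and>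
      (\<forall>v R. (\<forall>\<epsilon>>0. \<forall>\<^sub>F n in F. h v n \<le> R + \<epsilon>) \<longrightarrow> l q + inner_wrt M (v - q) (v - q) \<le> R)"
    if F: "F \<noteq> bot" "F \<le> sequentially" for F
  proof -
    obtain q \<rho> where q: "\<And>\<epsilon>. \<epsilon> > 0 \<Longrightarrow> \<forall>\<^sub>F n in F. h q n \<le> \<rho> + \<epsilon>"
      "\<And>v R. (\<And>\<epsilon>. \<epsilon> > 0 \<Longrightarrow> \<forall>\<^sub>F n in F. h v n \<le> R + \<epsilon>)
        \<Longrightarrow> \<rho> + inner_wrt M (v - q) (v - q) \<le> R"
      using asymptotic_center[of M F y B, OF M F(1) B, folded h_def] by auto
    have "\<forall>\<^sub>F n in F. h (T q) n \<le> \<rho> + \<epsilon>" if "\<epsilon> > 0" for \<epsilon>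
    proof -
      \<comment> \<open>\<open>T q\<close> is as good a center as \<open>q\<close>, since \<open>T\<close> is nonexpansive and \<open>y n - T (y n)\<close> vanishes.\<close>
      define \<eta> where "\<eta> n = norm (y (Suc n) - y n)" for n
      define K where "K = B + norm (T q)"
      have "(\<lambda>n. D * \<eta> n * \<eta> n + 2 * (D * \<eta> n * K)) \<longlonglongrightarrow> D * 0 * 0 + 2 * (D * 0 * K)"
        unfolding \<eta>_def by (intro tendsto_intros tendsto_norm_zero regular)
      then have "\<forall>\<^sub>F n in sequentially. D * \<eta> n * \<eta> n + 2 * (D * \<eta> n * K) < \<epsilon> / 2"
        by (rule order_tendstoD) (use that in simp)
      then have "\<forall>\<^sub>F n in F. D * \<eta> n * \<eta> n + 2 * (D * \<eta> n * K) < \<epsilon> / 2"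
        using F(2) by (rule filter_leD[rotated])
      moreover have "\<forall>\<^sub>F n in F. h q n \<le> \<rho> + \<epsilon> / 2" using q(1)[of "\<epsilon> / 2"] that by simp
      ultimately show ?thesis
      proof eventually_elim
        case (elim n)
        define d w where "d = y n - y (Suc n)" and "w = y (Suc n) - T q"
        have norm_d: "norm d = \<eta> n" by (simp add: d_def \<eta>_def norm_minus_commute)
        have norm_w: "norm w \<le> K"
          using B[of "Suc n"] norm_triangle_ineq4[of "y (Suc n)" "T q"] by (simp add: w_def K_def)
        have "h (T q) n = inner_wrt M d d + 2 * inner_wrt M d w + inner_wrt M w w"
          by (simp add: h_def d_def w_def simps inner_wrt_commute[OF M, of "y n" "y (Suc n)"]
              inner_wrt_commute[OF M, of "T q" "y n"]
              inner_wrt_commute[OF M, of "T q" "y (Suc n)"])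
        moreover have "inner_wrt M w w \<le> h q n"
          using nonexp[of "y n" q] by (simp add: w_def h_def step)
        moreover have "inner_wrt M d d \<le> D * \<eta> n * \<eta> n" using D(2)[of d d] norm_d by simp
        moreover have "inner_wrt M d w \<le> D * \<eta> n * K"
        proof -
          have "D * norm d * norm w \<le> D * norm d * K"
            using norm_w D(1) by (intro mult_left_mono) auto
          then show ?thesis using D(2)[of d w] norm_d by simp
        qed
        ultimately show ?case using elim by linarith
      qed
    qed
    from q(2)[OF this] have "T q - q = 0" by (intro inner_wrt_eq_0[OF M]) simp
    then have Tq: "T q = q" by simp
    have "\<rho> \<le> l q"
    proof -
      have "\<forall>\<^sub>F n in F. h q n \<le> l q + \<epsilon>" if "\<epsilon> > 0" for \<epsilon>
      proof (rule filter_leD[OF F(2)])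
        have "\<forall>\<^sub>F n in sequentially. h q n < l q + \<epsilon>"
          using lim[OF Tq] that by (intro order_tendstoD) auto
        then show "\<forall>\<^sub>F n in sequentially. h q n \<le> l q + \<epsilon>"
          by eventually_elim simp
      qed
      from q(2)[OF this] show ?thesis by (simp add: simps)
    qed
    moreover have "l q \<le> \<rho>"
    proof (rule field_le_epsilon)
      fix \<epsilon> :: real assume "\<epsilon> > 0"
      then obtain n where "h q n \<le> \<rho> + \<epsilon>" using q(1) eventually_happens'[OF F(1)] by blast
      moreover have "l q \<le> h q n" by (rule decseq_ge[OF fejer[OF Tq] lim[OF Tq]])
      ultimately show "l q \<le> \<rho> + \<epsilon>" by linarith
    qed
    ultimately have "\<rho> = l q" by simp
    then show ?thesis using q Tq by blast
  qed

  have limit_bound: "\<forall>\<epsilon>>0. \<forall>\<^sub>F n in F. h v n \<le> l v + \<epsilon>"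
    if "T v = v" "F \<le> sequentially" for v F
  proof (intro allI impI filter_leD[OF that(2)])
    fix \<epsilon> :: real assume "\<epsilon> > 0"
    then have "\<forall>\<^sub>F n in sequentially. h v n < l v + \<epsilon>"
      using lim[OF that(1)] by (intro order_tendstoD) auto
    then show "\<forall>\<^sub>F n in sequentially. h v n \<le> l v + \<epsilon>" by eventually_elim simp
  qed
  obtain q where Tq: "T q = q" and q: "\<And>v R. (\<forall>\<epsilon>>0. \<forall>\<^sub>F n in sequentially. h v n \<le> R + \<epsilon>)
      \<Longrightarrow> l q + inner_wrt M (v - q) (v - q) \<le> R"
    using center[of sequentially] by auto
  have upper: "\<forall>\<^sub>F n in sequentially. inner_wrt M (y n - q) w < \<eta>" if "\<eta> > 0" for w \<eta>
  proof (rule ccontr)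
    \<comment> \<open>The filter of the indices that violate the claim.\<close>
    define F where "F = inf sequentially (principal {n. \<not> inner_wrt M (y n - q) w < \<eta>})"
    assume "\<not> ?thesis"
    then have F: "F \<noteq> bot" "F \<le> sequentially"
      by (auto simp: F_def trivial_limit_def eventually_inf_principal)
    obtain q' where Tq': "T q' = q'" and q'1: "\<forall>\<epsilon>>0. \<forall>\<^sub>F n in F. h q' n \<le> l q' + \<epsilon>"
      and q'2: "\<And>v R. (\<forall>\<epsilon>>0. \<forall>\<^sub>F n in F. h v n \<le> R + \<epsilon>)
        \<Longrightarrow> l q' + inner_wrt M (v - q') (v - q') \<le> R"
      using center[OF F] by auto
    have "q' - q = 0"
      using q[OF limit_bound[OF Tq' order_refl]] q'2[OF limit_bound[OF Tq F(2)]]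
      by (intro inner_wrt_eq_0[OF M]) (simp add: simps)
    then have [simp]: "q' = q" by simp
    have "\<forall>\<^sub>F n in F. h (q + w) n \<le> l q + inner_wrt M w w - 2 * \<eta> + \<epsilon>" if "\<epsilon> > 0" for \<epsilon>
    proof -
      have "\<forall>\<^sub>F n in F. \<not> inner_wrt M (y n - q) w < \<eta>"
        by (simp add: F_def eventually_inf_principal)
      moreover have "\<forall>\<^sub>F n in F. h q n \<le> l q + \<epsilon>" using q'1 that by simp
      ultimately show ?thesis
      proof eventually_elim
        case (elim n)
        have "h (q + w) n = h q n - 2 * inner_wrt M (y n - q) w + inner_wrt M w w"
          by (simp add: h_def simps inner_wrt_commute[OF M, of w "y n"]
              inner_wrt_commute[OF M, of w q])
        with elim show ?case by simp
      qed
    qed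
    then have "l q + inner_wrt M w w \<le> l q + inner_wrt M w w - 2 * \<eta>"
      using q'2[of "q + w" "l q + inner_wrt M w w - 2 * \<eta>"] by simp
    with that show False by simp
  qed
  have "(\<lambda>n. inner (y n) u) \<longlonglongrightarrow> inner q u" for u
  proof (rule LIMSEQ_I)
    fix \<eta> :: real assume "\<eta> > 0"
    define w where "w = inv M u"
    have "M w = u" unfolding w_def using strongly_positive_bij[OF M]
      by (simp add: bij_is_surj surj_f_inv_f)
    then have eq: "inner (y n) u - inner q u = inner_wrt M (y n - q) w" for n
      by (simp add: inner_wrt_def inner_diff_left)
    have "\<forall>\<^sub>F n in sequentially. \<bar>inner_wrt M (y n - q) w\<bar> < \<eta>"
      using upper[OF \<open>\<eta> > 0\<close>, of w] upper[OF \<open>\<eta> > 0\<close>, of "- w"]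
      by eventually_elim (simp add: simps)
    then show "\<exists>N. \<forall>n\<ge>N. norm (inner (y n) u - inner q u) < \<eta>"
      by (simp add: eq eventually_sequentially)
  qed
  with Tq show ?thesis by (auto simp: weakly_converges_def)
qed

section \<open>The forward-backward residual\<close>

lemma maximally_monotone_memI:
  assumes A: "maximally_monotone A"
    and related: "\<And>a b. b \<in> A a \<Longrightarrow> 0 \<le> inner (u - b) (x - a)"
  shows "u \<in> A x"
proof -
  define B where "B = A(x := insert u (A x))"
  have "monotone_operator A" using A by (simp add: maximally_monotone_def)
  then have "monotone_operator B"
    unfolding monotone_operator_def
  proof (intro allI ballI)
    fix x1 x2 u1 u2
    assume mono: "\<forall>x y. \<forall>u\<in>A x. \<forall>v\<in>A y. 0 \<le> inner (u - v) (x - y)"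
      and "u1 \<in> B x1" "u2 \<in> B x2"
    then consider "u1 \<in> A x1" "u2 \<in> A x2" | "u1 = u" "x1 = x" "u2 \<in> A x2"
      | "u1 \<in> A x1" "u2 = u" "x2 = x" | "u1 = u" "x1 = x" "u2 = u" "x2 = x"
      by (auto simp: B_def split: if_splits)
    then show "0 \<le> inner (u1 - u2) (x1 - x2)"
    proof cases
      case 3
      have "inner (u1 - u2) (x1 - x2) = inner (u2 - u1) (x2 - x1)"
        by (metis inner_minus_left inner_minus_right minus_diff_eq add.inverse_inverse)
      then show ?thesis using 3 related by simp
    qed (use mono related in auto)
  qed
  moreover have "\<forall>x. A x \<subseteq> B x" by (auto simp: B_def)
  ultimately have "B = A" using A by (auto simp: maximally_monotone_def)
  moreover have "u \<in> B x" by (simp add: B_def)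
  ultimately show ?thesis by simp
qed

definition forward_backward_residual ::
    "('a::real_inner \<Rightarrow> 'a) \<Rightarrow> real \<Rightarrow> ('a \<Rightarrow> 'a set) \<Rightarrow> ('a \<Rightarrow> 'a) \<Rightarrow> 'a \<Rightarrow> 'a" where
  "forward_backward_residual M \<gamma> A C y = y - resolvent_wrt M \<gamma> A (M y - \<gamma> *\<^sub>R C y)"

context
  fixes M :: "'a::{real_inner,complete_space} \<Rightarrow> 'a" and A :: "'a \<Rightarrow> 'a set" and \<gamma> :: real
  assumes M: "strongly_positive_operator M" and A: "maximally_monotone A" and \<gamma>: "\<gamma> > 0"
begin

lemma resolvent_wrt_eqI:
  assumes "u \<in> A p" "M p + \<gamma> *\<^sub>R u = z"
  shows "resolvent_wrt M \<gamma> A z = p"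
proof -
  have unique: "p' = p" if "u' \<in> A p'" "M p' + \<gamma> *\<^sub>R u' = z" for p' u'
  proof -
    have "M p' - M p = \<gamma> *\<^sub>R u - \<gamma> *\<^sub>R u'"
    proof -
      have "M p' = M p + \<gamma> *\<^sub>R u - \<gamma> *\<^sub>R u'"
        unfolding assms(2) using that(2) by (metis add_diff_cancel_right')
      then show ?thesis by simp
    qed
    then have "M (p' - p) = - (\<gamma> *\<^sub>R (u' - u))"
      by (simp add: linear_diff[OF strongly_positive_linear[OF M]] scaleR_diff_right)
    moreover have "0 \<le> inner (u' - u) (p' - p)"
      using A that(1) assms(1) by (auto simp: maximally_monotone_def monotone_operator_def)
    ultimately have "inner_wrt M (p' - p) (p' - p) \<le> 0"
      using \<gamma> by (simp add: inner_wrt_def inner_commute[of "p' - p" "u' - u"])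
    from inner_wrt_eq_0[OF M this] show ?thesis by simp
  qed
  have mem_iff: "p' \<in> inverse_operator (add_operator M (scale_operator \<gamma> A)) z \<longleftrightarrow>
      (\<exists>u'\<in>A p'. M p' + \<gamma> *\<^sub>R u' = z)" for p'
    by (auto simp: inverse_operator_def add_operator_def scale_operator_def)
  have "inverse_operator (add_operator M (scale_operator \<gamma> A)) z = {p}"
    using assms unique unfolding set_eq_iff mem_iff singleton_iff by metis
  then show ?thesis by (simp add: resolvent_wrt_def)
qed

text \<open>
  Minty's theorem for \<open>\<gamma> A - z\<close>: a point \<open>p\<close> with \<open>- M p \<in> \<gamma> A p - z\<close> is the resolvent of \<open>z\<close>.
\<close>

lemma resolvent_wrt_inclusion:
  "\<exists>u\<in>A (resolvent_wrt M \<gamma> A z). M (resolvent_wrt M \<gamma> A z) + \<gamma> *\<^sub>R u = z"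
proof -
  define G where "G = {(a, \<gamma> *\<^sub>R b - z) | a b. b \<in> A a}"
  have "\<exists>x. (x, - M x) \<in> G"
  proof (rule minty_graph[OF M])
    fix a b a' b' assume "(a, b) \<in> G" "(a', b') \<in> G"
    then obtain v v' where "v \<in> A a" "v' \<in> A a'" "b - b' = \<gamma> *\<^sub>R (v - v')"
      by (auto simp: G_def scaleR_diff_right)
    then show "0 \<le> inner (a - a') (b - b')"
      using A \<gamma> by (simp add: maximally_monotone_def monotone_operator_def
          inner_commute[of "a - a'" "v - v'"])
  next
    fix x u assume related: "\<And>a b. (a, b) \<in> G \<Longrightarrow> 0 \<le> inner (x - a) (u - b)"
    have "(1 / \<gamma>) *\<^sub>R (u + z) \<in> A x"
    proof (rule maximally_monotone_memI[OF A])
      fix a b assume "b \<in> A a"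
      then have "0 \<le> inner (x - a) (u - (\<gamma> *\<^sub>R b - z))" by (intro related) (auto simp: G_def)
      moreover have "(1 / \<gamma>) *\<^sub>R (u + z) - b = (1 / \<gamma>) *\<^sub>R (u - (\<gamma> *\<^sub>R b - z))"
        using \<gamma> by (simp add: algebra_simps)
      ultimately show "0 \<le> inner ((1 / \<gamma>) *\<^sub>R (u + z) - b) (x - a)"
        using \<gamma> by (simp add: inner_commute[of _ "x - a"])
    qed
    moreover have "u = \<gamma> *\<^sub>R ((1 / \<gamma>) *\<^sub>R (u + z)) - z" using \<gamma> by simp
    ultimately show "(x, u) \<in> G" unfolding G_def by blast
  qed
  then obtain p u where p: "u \<in> A p" "- M p = \<gamma> *\<^sub>R u - z" by (auto simp: G_def)
  then have "M p + \<gamma> *\<^sub>R u = z" by (simp add: algebra_simps)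
  then show ?thesis using p(1) resolvent_wrt_eqI by auto
qed

lemma forward_backward_residual_eq_0_iff:
  "forward_backward_residual M \<gamma> A C x = 0 \<longleftrightarrow> x \<in> zeros (add_operator C A)"
proof
  assume "forward_backward_residual M \<gamma> A C x = 0"
  then have "resolvent_wrt M \<gamma> A (M x - \<gamma> *\<^sub>R C x) = x"
    by (simp add: forward_backward_residual_def)
  then obtain u where u: "u \<in> A x" "M x + \<gamma> *\<^sub>R u = M x - \<gamma> *\<^sub>R C x"
    using resolvent_wrt_inclusion[of "M x - \<gamma> *\<^sub>R C x"] by auto
  then have "\<gamma> *\<^sub>R (C x + u) = 0"
    by (simp add: scaleR_add_right diff_conv_add_uminus del: add_uminus_conv_diff scaleR_eq_0_iff)
  with \<gamma> u(1) show "x \<in> zeros (add_operator C A)" by (auto simp: zeros_def add_operator_def)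
next
  assume "x \<in> zeros (add_operator C A)"
  then obtain u where u: "u \<in> A x" "C x + u = 0" by (auto simp: zeros_def add_operator_def)
  then have "u = - C x" by (simp add: eq_neg_iff_add_eq_0 add.commute)
  then have "M x + \<gamma> *\<^sub>R u = M x - \<gamma> *\<^sub>R C x" by simp
  then show "forward_backward_residual M \<gamma> A C x = 0"
    using resolvent_wrt_eqI[OF u(1)] by (simp add: forward_backward_residual_def)
qed

text \<open>
  The monotonicity of \<open>A\<close> at two resolvent values makes the residual difference \<open>d\<close> firmly
  nonexpansive up to \<open>\<gamma> \<langle>c, d - (x - y)\<rangle>\<close>, where \<open>c = C x - C y\<close>. By cocoercivity of \<open>C\<close> and completing the
  square in the norm of \<open>inv M\<close>, that error is at most \<open>\<gamma> b / 4\<close> times the squared norm of \<open>d\<close>.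
\<close>

lemma forward_backward_residual_cocoercive:
  assumes C: "cocoercive_wrt M \<beta> C" and \<beta>: "0 \<le> \<beta>" "\<beta> \<le> b" "0 < b"
  defines "G \<equiv> forward_backward_residual M \<gamma> A C"
  shows "(1 - \<gamma> * b / 4) * inner_wrt M (G x - G y) (G x - G y) \<le> inner_wrt M (G x - G y) (x - y)"
proof -
  define J where "J z = resolvent_wrt M \<gamma> A (M z - \<gamma> *\<^sub>R C z)" for z
  define c d where "c = C x - C y" and "d = G x - G y"
  have W: "strongly_positive_operator (inv M)" by (rule strongly_positive_inv[OF M])
  note Ms = inner_wrt_simps[OF M] and Ws = inner_wrt_simps[OF W]
  have lin: "linear M" by (rule strongly_positive_linear[OF M])
  have J_diff: "J x - J y = (x - y) - d"
    by (simp add: d_def G_def forward_backward_residual_def J_def)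
  obtain u where u: "u \<in> A (J x)" "M (J x) + \<gamma> *\<^sub>R u = M x - \<gamma> *\<^sub>R C x"
    using resolvent_wrt_inclusion unfolding J_def by blast
  obtain v where v: "v \<in> A (J y)" "M (J y) + \<gamma> *\<^sub>R v = M y - \<gamma> *\<^sub>R C y"
    using resolvent_wrt_inclusion unfolding J_def by blast
  have "0 \<le> \<gamma> * inner (u - v) (J x - J y)"
    using A u(1) v(1) \<gamma> by (simp add: maximally_monotone_def monotone_operator_def)
  also have "\<dots> = inner (M d - \<gamma> *\<^sub>R c) (J x - J y)"
  proof -
    have "\<gamma> *\<^sub>R u - \<gamma> *\<^sub>R v = M x - \<gamma> *\<^sub>R C x - M (J x) - (M y - \<gamma> *\<^sub>R C y - M (J y))"
      using u(2) v(2) by (metis add_diff_cancel_left')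
    also have "\<dots> = M (x - y - (J x - J y)) - \<gamma> *\<^sub>R c"
      by (simp add: linear_diff[OF lin] c_def scaleR_diff_right)
    also have "x - y - (J x - J y) = d" by (simp add: J_diff)
    finally show ?thesis by (metis inner_scaleR_left scaleR_diff_right)
  qed
  also have "\<dots> = inner_wrt M d (x - y) - inner_wrt M d d - \<gamma> * inner c (x - y) + \<gamma> * inner c d"
  proof -
    have "inner (M d) w = inner_wrt M d w" for w
      using M by (simp add: inner_wrt_def strongly_positive_operator_def)
    then show ?thesis by (simp add: J_diff inner_diff Ms algebra_simps)
  qed
  finally have mono: "inner_wrt M d d + \<gamma> * inner c (x - y) - \<gamma> * inner c d \<le> inner_wrt M d (x - y)"
    by simp
  have coc: "inner_wrt (inv M) c c \<le> \<beta> * inner c (x - y)"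
    using C by (simp add: cocoercive_wrt_def norm_wrt_square[OF W] c_def)
  \<comment> \<open>This sign allows \<open>\<beta>\<close> to be replaced by the larger constant \<open>b\<close>. For \<open>\<beta> = 0\<close> it holds because
    \<open>C\<close> is then constant.\<close>
  have "0 \<le> inner c (x - y)"
  proof (cases "\<beta> = 0")
    case True
    then have "c = 0" using coc by (intro inner_wrt_eq_0[OF W]) simp
    then show ?thesis by simp
  next
    case False
    then show ?thesis using coc inner_wrt_nonneg[OF W, of c] \<beta>(1) zero_le_mult_iff
      by (smt (verit) mult_nonneg_nonpos)
  qed
  then have "\<beta> * inner c (x - y) \<le> b * inner c (x - y)" using \<beta>(2) by (intro mult_right_mono)
  with coc have coc': "inner_wrt (inv M) c c \<le> b * inner c (x - y)" by linarith
  have "0 \<le> inner_wrt (inv M) (c - (b / 2) *\<^sub>R M d) (c - (b / 2) *\<^sub>R M d)"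
    by (rule inner_wrt_nonneg[OF W])
  also have "\<dots> = inner_wrt (inv M) c c - b * inner c d + (b\<^sup>2 / 4) * inner_wrt M d d"
  proof -
    have "inv M (M d) = d" using strongly_positive_bij[OF M] by (simp add: bij_is_inj)
    then have "inner_wrt (inv M) c (M d) = inner c d" "inner_wrt (inv M) (M d) (M d) = inner_wrt M d d"
      by (simp_all add: inner_wrt_def inner_commute[of "M d" d])
    then show ?thesis
      by (simp add: Ws inner_wrt_commute[OF W, of "M d" c] power2_eq_square algebra_simps)
  qed
  finally have "0 \<le> b * (inner c (x - y) - inner c d + (b / 4) * inner_wrt M d d)"
    using coc' by (simp add: power2_eq_square algebra_simps)
  then have "0 \<le> \<gamma> * (inner c (x - y) - inner c d + (b / 4) * inner_wrt M d d)"
    using \<beta>(3) \<gamma> by (simp add: zero_le_mult_iff)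
  with mono show ?thesis unfolding d_def[symmetric] by (simp add: algebra_simps)
qed

end

section \<open>The energy of an anchored iteration\<close>

text \<open>
  The factor \<open>\<mu>\<close> is chosen so that the terms in \<open>\<langle>r, z - x\<rangle>\<close> cancel when the anchor moves by a
  multiple of \<open>\<mu> r\<close>.
\<close>

definition anchored_energy ::
    "('a::real_inner \<Rightarrow> 'a) \<Rightarrow> real \<Rightarrow> 'a \<Rightarrow> real \<Rightarrow> 'a \<Rightarrow> 'a \<Rightarrow> 'a \<Rightarrow> real" where
  "anchored_energy M \<mu> x \<theta> y r z =
     \<mu> * (\<theta> * (\<theta> - 1) * inner_wrt M r r - 2 * \<theta> * inner_wrt M r (z - y))
     + inner_wrt M (z - x) (z - x)"

text \<open>
  Cocoercivity turns the cross term into one with \<open>z - x\<close>; completing the square in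
  \<open>z - x - \<mu> \<theta> r\<close> then costs \<open>\<mu>\<^sup>2 \<theta>\<^sup>2 \<parallel>r\<parallel>\<^sup>2\<close> of the available \<open>\<mu> \<theta>\<^sup>2 \<parallel>r\<parallel>\<^sup>2\<close>.
\<close>

lemma anchored_energy_ge:
  assumes M: "strongly_positive_operator M"
    and "0 \<le> \<mu>" "0 \<le> \<theta>"
    and coc: "inner_wrt M r r \<le> 2 * inner_wrt M r (y - x)"
  shows "\<mu> * (1 - \<mu>) * \<theta>\<^sup>2 * inner_wrt M r r \<le> anchored_energy M \<mu> x \<theta> y r z"
proof -
  note Ms = inner_wrt_simps[OF M]
  have "0 \<le> inner_wrt M ((z - x) - (\<mu> * \<theta>) *\<^sub>R r) ((z - x) - (\<mu> * \<theta>) *\<^sub>R r)"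
    by (rule inner_wrt_nonneg[OF M])
  also have "\<dots> = inner_wrt M (z - x) (z - x) - 2 * (\<mu> * \<theta>) * inner_wrt M r (z - x)
      + (\<mu> * \<theta>)\<^sup>2 * inner_wrt M r r"
    by (simp only: Ms(3-6) inner_wrt_commute[OF M, of z r] inner_wrt_commute[OF M, of x r])
       (simp add: power2_eq_square algebra_simps)
  finally have "0 \<le> inner_wrt M (z - x) (z - x) - 2 * (\<mu> * \<theta>) * inner_wrt M r (z - x)
      + (\<mu> * \<theta>)\<^sup>2 * inner_wrt M r r" .
  moreover have "\<mu> * \<theta> * inner_wrt M r r \<le> \<mu> * \<theta> * (2 * inner_wrt M r (y - x))"
    using assms by (intro mult_left_mono) auto
  moreover have "inner_wrt M r (z - y) = inner_wrt M r (z - x) - inner_wrt M r (y - x)"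
    by (simp add: Ms)
  ultimately show ?thesis
    unfolding anchored_energy_def by (simp only: power2_eq_square right_diff_distrib) argo
qed

text \<open>
  Put \<open>s = y' - (y - r)\<close>. Cocoercivity between consecutive iterates is equivalent to
  \<open>\<parallel>r'\<parallel>\<^sup>2 - 2 \<langle>r', s\<rangle> \<le> \<parallel>r\<parallel>\<^sup>2 - 2 \<langle>r, s\<rangle>\<close>, and \<open>z' - y' = (\<theta>' - 1) s\<close>.
  Multiplied by \<open>\<mu> \<theta>' (\<theta>' - 1)\<close>, this inequality carries the new cross term to the old one. The
  motion of the anchor produces the remaining terms, which cocoercivity relative to the zero \<open>x\<close>
  controls.
\<close>

lemma anchored_energy_decrease:
  assumes M: "strongly_positive_operator M"
    and \<mu>: "0 \<le> \<mu>" and \<delta>: "0 \<le> \<delta>" "\<delta> = 1 + \<theta> - \<theta>'" and \<theta>': "1 \<le> \<theta>'"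
    and z': "z' = z - (\<delta> * \<mu>) *\<^sub>R r"
    and y': "\<theta>' *\<^sub>R y' = z' + (\<theta>' - 1) *\<^sub>R (y - r)"
    and coc: "inner_wrt M (r' - r) (r' - r) \<le> 2 * inner_wrt M (r' - r) (y' - y)"
    and coc_x: "inner_wrt M r r \<le> 2 * inner_wrt M r (y - x)"
  shows "anchored_energy M \<mu> x \<theta>' y' r' z' + \<mu> * (1 - \<mu>) * \<delta> * (2 * \<theta> - \<delta>) * inner_wrt M r r
    \<le> anchored_energy M \<mu> x \<theta> y r z"
proof -
  note Ms = inner_wrt_simps[OF M]
  define s where "s = y' - y + r"
  define a a' P Q k m Z where "a = inner_wrt M r r" and "a' = inner_wrt M r' r'"
    and "P = inner_wrt M r' s" and "Q = inner_wrt M r s" and "k = inner_wrt M r (z - y)"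
    and "m = inner_wrt M r (z - x)" and "Z = inner_wrt M (z - x) (z - x)"
  have "y' - y = s - r" by (simp add: s_def)
  then have coc': "a' - 2 * P \<le> a - 2 * Q"
    using coc by (simp add: Ms a_def a'_def P_def Q_def inner_wrt_commute[OF M, of r r'])
  have "z' - y' = (\<theta>' - 1) *\<^sub>R s"
  proof -
    have "z' = \<theta>' *\<^sub>R y' - (\<theta>' - 1) *\<^sub>R (y - r)" using y' by (simp add: eq_diff_eq)
    then show ?thesis by (simp add: s_def algebra_simps)
  qed
  then have P: "inner_wrt M r' (z' - y') = (\<theta>' - 1) * P" by (simp add: Ms P_def)
  have "\<theta>' *\<^sub>R s = (z - y) + (1 - \<delta> * \<mu>) *\<^sub>R r"
  proof -
    have "\<theta>' *\<^sub>R s = \<theta>' *\<^sub>R y' - \<theta>' *\<^sub>R (y - r)" by (simp add: s_def algebra_simps)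
    then show ?thesis by (simp add: y' z' algebra_simps)
  qed
  then have "inner_wrt M r (\<theta>' *\<^sub>R s) = inner_wrt M r ((z - y) + (1 - \<delta> * \<mu>) *\<^sub>R r)" by simp
  then have Q: "\<theta>' * Q = k + (1 - \<delta> * \<mu>) * a"
    by (simp only: Ms(2,6) Q_def k_def a_def)
  have "z' - x = (z - x) - (\<delta> * \<mu>) *\<^sub>R r" by (simp add: z')
  from arg_cong[OF this, of "\<lambda>w. inner_wrt M w w"] have "inner_wrt M (z' - x) (z' - x)
      = inner_wrt M ((z - x) - (\<delta> * \<mu>) *\<^sub>R r) ((z - x) - (\<delta> * \<mu>) *\<^sub>R r)" .
  also have "\<dots> = Z - 2 * (\<delta> * \<mu>) * m + (\<delta> * \<mu>)\<^sup>2 * a"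
    by (simp only: Ms(3-6) inner_wrt_commute[OF M, of z r] inner_wrt_commute[OF M, of x r]
        Z_def m_def a_def) (simp add: power2_eq_square algebra_simps)
  finally have Z: "inner_wrt M (z' - x) (z' - x) = Z - 2 * (\<delta> * \<mu>) * m + (\<delta> * \<mu>)\<^sup>2 * a" .
  have "inner_wrt M r (y - x) = m - k" by (simp add: Ms m_def k_def)
  then have "a \<le> 2 * (m - k)" using coc_x by (simp add: a_def)
  then have m: "(\<delta> * \<mu>) * a \<le> (\<delta> * \<mu>) * (2 * (m - k))"
    using \<mu> \<delta>(1) by (intro mult_left_mono) auto
  have "\<mu> * \<theta>' * (\<theta>' - 1) * (a' - 2 * P) \<le> \<mu> * \<theta>' * (\<theta>' - 1) * (a - 2 * Q)"
    using coc' \<mu> \<theta>' by (intro mult_left_mono) auto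
  also have "\<dots> = \<mu> * (\<theta>' - 1) * (\<theta>' * a - 2 * (\<theta>' * Q))" by (simp add: algebra_simps)
  also have "\<dots> = \<mu> * (\<theta> - \<delta>) * ((1 + \<theta> - \<delta>) * a - 2 * (k + (1 - \<delta> * \<mu>) * a))"
    unfolding Q by (simp add: \<delta>(2))
  finally show ?thesis
    using m unfolding anchored_energy_def P Z
    by (simp add: power2_eq_square algebra_simps flip: a_def a'_def k_def Z_def)
qed

text \<open>
  By the mean value theorem, as the derivative of \<open>x\<^sup>e\<close> is at most \<open>e\<close> for \<open>x \<ge> 1\<close>. This bounds the
  steps of the anchor from below.
\<close>

lemma powr_increment_le:
  fixes x e :: real
  assumes "1 \<le> x" "0 \<le> e" "e \<le> 1"
  shows "(1 + x) powr e - x powr e \<le> e"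
proof -
  have "\<exists>c. x < c \<and> c < 1 + x \<and> (1 + x) powr e - x powr e = (1 + x - x) * (e * c powr (e - 1))"
    using assms by (intro MVT2) (auto intro!: derivative_eq_intros)
  then obtain c where c: "x < c" "(1 + x) powr e - x powr e = e * c powr (e - 1)" by auto
  have "c powr (e - 1) \<le> c powr 0" using assms c(1) by (intro powr_mono) auto
  then show ?thesis using c assms mult_left_mono[of "c powr (e - 1)" 1 e] by simp
qed

section \<open>Convergence of forward-backward splitting with momentum\<close>

theorem corollary1:
  fixes M C :: "'a::{real_inner,complete_space} \<Rightarrow> 'a"
    and A :: "'a \<Rightarrow> 'a set"
    and \<beta> e \<epsilon> \<gamma> \<beta>' :: real
    and l :: "nat \<Rightarrow> real"
    and y p :: "int \<Rightarrow> 'a"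
  assumes "strongly_positive_operator M"
    and "\<beta> \<ge> 0"
    and "maximally_monotone A"
    and "cocoercive_wrt M \<beta> C"
    and "zeros (add_operator C A) \<noteq> {}"
    and "0 \<le> e" and "e \<le> 1"
    and "\<epsilon> > 0" and "\<gamma> > 0" and "\<beta>' \<ge> \<beta>"
    and "l 0 = (1 - \<gamma> * \<beta>' / 4) powr e"
    and "l 0 > 0"
    and "\<epsilon> \<le> \<gamma> * \<beta>'" and "\<gamma> * \<beta>' \<le> 4 - 2 * l 0 - \<epsilon>"
    and "\<And>n. l n = (1 + real n) powr e * l 0"
    and "y (-1) = y 0" and "p (-1) = y 0"
    and "\<And>n::nat. p (int n) =
           resolvent_wrt M \<gamma> A (M (y (int n)) - \<gamma> *\<^sub>R C (y (int n)))"
    and "\<And>n::nat. y (int n + 1) =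
           y (int n)
           + (l 0 * l n / l (n + 1)
              + (l (n + 1) - l 0) / l (n + 1) * ((4 - \<gamma> * \<beta>' - 2 * l 0) / 2))
             *\<^sub>R (p (int n) - y (int n))
           + ((l n - l 0) / l (n + 1))
             *\<^sub>R ((y (int n) - y (int n - 1))
                  + ((4 - \<gamma> * \<beta>') / 2) *\<^sub>R (y (int n - 1) - p (int n - 1)))"
  shows "(e > 0 \<longrightarrow>
           (\<forall>x\<in>zeros (add_operator C A). \<forall>n::nat.
             (norm_wrt M ((1 / \<gamma>) *\<^sub>R (p (int n) - y (int n))))\<^sup>2
             \<le> 2 * (norm_wrt M (y 0 - x))\<^sup>2
               / (\<gamma>\<^sup>2 * (4 - \<gamma> * \<beta>' - 2 * l 0) * l 0 * (1 + real n) powr (2 * e))))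
       \<and> (\<beta>' > \<beta> \<and> e < 1 \<longrightarrow>
           summable (\<lambda>n::nat. (norm (p (int n) - y (int n)))\<^sup>2))
       \<and> (e = 0 \<longrightarrow>
           (\<forall>n::nat. y (int n + 1) = p (int n) \<and>
              p (int n) = resolvent_wrt M \<gamma> A (M (y (int n)) - \<gamma> *\<^sub>R C (y (int n)))) \<and>
           (\<exists>x\<in>zeros (add_operator C A). weakly_converges (\<lambda>n. p (int n)) x))"
proof -
  define \<kappa> where "\<kappa> = 1 - \<gamma> * \<beta>' / 4"
  define \<mu> where "\<mu> = l 0 / (2 * \<kappa>)"
  define \<theta> where "\<theta> n = (1 + real n) powr e" for n
  define \<delta> where "\<delta> n = 1 + \<theta> n - \<theta> (Suc n)" for n
  define G where "G = forward_backward_residual M \<gamma> A C"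
  define Y where "Y n = y (int n)" for n
  define r where "r n = (2 * \<kappa>) *\<^sub>R G (Y n)" for n
  define z where "z n = Y 0 - (\<Sum>k<n. (\<delta> k * \<mu>) *\<^sub>R r k)" for n
  note M = assms(1)
  note Ms = inner_wrt_simps[OF M]
  have \<gamma>: "\<gamma> > 0" and e: "0 \<le> e" "e \<le> 1" by fact+
  have \<kappa>: "0 < l 0" "l 0 < 2 * \<kappa>" "0 < \<kappa>" using assms(8,12,14) unfolding \<kappa>_def by argo+
  have \<mu>: "0 < \<mu>" "\<mu> < 1" using \<kappa> by (auto simp: \<mu>_def)
  have \<theta>0: "\<theta> 0 = 1" by (simp add: \<theta>_def)
  have \<theta>: "1 \<le> \<theta> n" for n unfolding \<theta>_def using e by (intro ge_one_powr_ge_zero) auto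
  have l: "l n = \<theta> n * l 0" for n unfolding \<theta>_def by (rule assms(15))
  have \<delta>: "1 - e \<le> \<delta> n" "\<delta> n \<le> 1" "0 \<le> \<delta> n" for n
  proof -
    show "1 - e \<le> \<delta> n"
      using powr_increment_le[of "1 + real n" e] e by (simp add: \<delta>_def \<theta>_def)
    then show "0 \<le> \<delta> n" using e by simp
    show "\<delta> n \<le> 1" using e by (simp add: \<delta>_def \<theta>_def powr_mono2)
  qed
  have p: "p (int n) = Y n - G (Y n)" for n
    unfolding assms(18) G_def forward_backward_residual_def Y_def by simp
  have \<beta>': "0 < \<beta>'" using assms(8,13) \<gamma> by (metis less_le_trans zero_less_mult_pos)
  have G: "\<kappa> * inner_wrt M (G u - G v) (G u - G v) \<le> inner_wrt M (G u - G v) (u - v)" for u v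
    unfolding \<kappa>_def G_def 
    by (rule forward_backward_residual_cocoercive[OF M assms(3) \<gamma> assms(4,2,10) \<beta>'])
  have zero_iff: "G x = 0 \<longleftrightarrow> x \<in> zeros (add_operator C A)" for x
    unfolding G_def by (rule forward_backward_residual_eq_0_iff[OF M assms(3) \<gamma>])

  have coc: "inner_wrt M ((2 * \<kappa>) *\<^sub>R G u - (2 * \<kappa>) *\<^sub>R G v) ((2 * \<kappa>) *\<^sub>R G u - (2 * \<kappa>) *\<^sub>R G v)
      \<le> 2 * inner_wrt M ((2 * \<kappa>) *\<^sub>R G u - (2 * \<kappa>) *\<^sub>R G v) (u - v)" for u v
    using mult_left_mono[OF G[of u v], of "4 * \<kappa>"] \<kappa>(3)
    unfolding scaleR_diff_right[symmetric] Ms(5,6) by (simp add: mult_ac)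
  have z_Suc: "z (Suc n) = z n - (\<delta> n * \<mu>) *\<^sub>R r n" for n by (simp add: z_def)
  have \<mu>r: "(\<delta> n * \<mu>) *\<^sub>R r n = (\<delta> n * l 0) *\<^sub>R G (Y n)" for n
    using \<kappa>(3) by (simp add: \<mu>_def r_def)

  \<comment> \<open>The update rule, rewritten with the anchor: the premise \<open>prev\<close> says that the momentum term
    is the displacement of the anchor from the iterate.\<close>
  have average_step: "\<theta> (Suc n) *\<^sub>R Y (Suc n) = z (Suc n) + (\<theta> (Suc n) - 1) *\<^sub>R (Y n - r n)"
    if prev: "(\<theta> n - 1) *\<^sub>R ((Y n - y (int n - 1)) + (2 * \<kappa>) *\<^sub>R (y (int n - 1) - p (int n - 1)))
      = z n - Y n" for n
  proof -
    define a where "a = l 0 * l n / l (n + 1)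
        + (l (n + 1) - l 0) / l (n + 1) * ((4 - \<gamma> * \<beta>' - 2 * l 0) / 2)"
    define b where "b = (l n - l 0) / l (n + 1)"
    define w where "w = (Y n - y (int n - 1)) + (2 * \<kappa>) *\<^sub>R (y (int n - 1) - p (int n - 1))"
    have ne: "\<theta> (Suc n) \<noteq> 0" using \<theta>[of "Suc n"] by simp
    have a: "\<theta> (Suc n) * a = l 0 * \<theta> n + (\<theta> (Suc n) - 1) * (2 * \<kappa> - l 0)"
    proof -
      have eq: "(4 - \<gamma> * \<beta>' - 2 * l 0) / 2 = 2 * \<kappa> - l 0" by (simp add: \<kappa>_def field_simps)
      show ?thesis unfolding a_def eq using ne \<kappa>(1) l[of n] l[of "Suc n"]
        by (simp add: field_simps)
    qed
    have b: "\<theta> (Suc n) * b = \<theta> n - 1"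
      using ne \<kappa>(1) l[of n] l[of "Suc n"] by (simp add: b_def field_simps)
    have "Y (Suc n) = Y n + a *\<^sub>R (p (int n) - Y n) + b *\<^sub>R w"
    proof -
      have "(4 - \<gamma> * \<beta>') / 2 = 2 * \<kappa>" by (simp add: \<kappa>_def field_simps)
      then show ?thesis using assms(19)[of n] unfolding Y_def a_def b_def w_def
        by (simp only: of_nat_Suc add.commute[of 1])
    qed
    then have "\<theta> (Suc n) *\<^sub>R Y (Suc n)
        = \<theta> (Suc n) *\<^sub>R Y n - (\<theta> (Suc n) * a) *\<^sub>R G (Y n) + (\<theta> (Suc n) * b) *\<^sub>R w"
      by (simp add: p scaleR_add_right scaleR_diff_right)
    also have "(\<theta> (Suc n) * b) *\<^sub>R w = z n - Y n" using prev by (simp add: b w_def)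
    also have "\<theta> (Suc n) * a = (\<theta> (Suc n) - 1) * (2 * \<kappa>) + \<delta> n * l 0"
      unfolding a by (simp add: \<delta>_def algebra_simps)
    finally show ?thesis unfolding z_Suc \<mu>r by (simp add: r_def algebra_simps)
  qed
  have momentum: "(\<theta> n - 1) *\<^sub>R ((Y n - y (int n - 1)) + (2 * \<kappa>) *\<^sub>R (y (int n - 1) - p (int n - 1)))
      = z n - Y n" for n
  proof (induction n)
    case 0
    show ?case by (simp add: \<theta>0 z_def)
  next
    case (Suc n)
    have "z (Suc n) = \<theta> (Suc n) *\<^sub>R Y (Suc n) - (\<theta> (Suc n) - 1) *\<^sub>R (Y n - r n)"
      using average_step[OF Suc] by (simp add: eq_diff_eq)
    moreover have "int (Suc n) - 1 = int n" by simp
    ultimately show ?case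
      by (simp only:) (simp add: p r_def algebra_simps flip: Y_def)
  qed
  note average = average_step[OF momentum]

  \<comment> \<open>The energy inequality summed over the iteration; the initial energy is the squared distance of
    \<open>y 0\<close> to the zero \<open>x\<close> because \<open>\<theta> 0 = 1\<close> and \<open>z 0 = y 0\<close>.\<close>
  have energy: "anchored_energy M \<mu> x (\<theta> n) (Y n) (r n) (z n)
      + (\<Sum>k<n. \<mu> * (1 - \<mu>) * \<delta> k * (2 * \<theta> k - \<delta> k) * inner_wrt M (r k) (r k))
      \<le> inner_wrt M (y 0 - x) (y 0 - x)" if x: "G x = 0" for x n
  proof (induction n)
    case 0
    show ?case by (simp add: anchored_energy_def \<theta>0 z_def Ms Y_def)
  next
    case (Suc n)
    have "anchored_energy M \<mu> x (\<theta> (Suc n)) (Y (Suc n)) (r (Suc n)) (z (Suc n))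
      + \<mu> * (1 - \<mu>) * \<delta> n * (2 * \<theta> n - \<delta> n) * inner_wrt M (r n) (r n)
      \<le> anchored_energy M \<mu> x (\<theta> n) (Y n) (r n) (z n)"
    proof (rule anchored_energy_decrease[OF M _ \<delta>(3) _ \<theta> z_Suc average])
      show "\<delta> n = 1 + \<theta> n - \<theta> (Suc n)" by (simp add: \<delta>_def)
    qed (use \<mu> coc[of "Y (Suc n)" "Y n"] coc[of "Y n" x] x in \<open>simp_all add: r_def\<close>)
    with Suc show ?case by simp
  qed
  have energy_ge: "\<mu> * (1 - \<mu>) * (\<theta> n)\<^sup>2 * inner_wrt M (r n) (r n)
      \<le> anchored_energy M \<mu> x (\<theta> n) (Y n) (r n) (z n)" if "G x = 0" for x n
    using \<mu>(1) \<theta>[of n] coc[of "Y n" x] that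
    by (intro anchored_energy_ge[OF M]) (simp_all add: r_def)
  have r_sq: "inner_wrt M (r n) (r n) = 4 * \<kappa>\<^sup>2 * inner_wrt M (G (Y n)) (G (Y n))" for n
    by (simp add: r_def Ms power2_eq_square)
  have sum_terms_nonneg:
    "0 \<le> \<mu> * (1 - \<mu>) * \<delta> k * (2 * \<theta> k - \<delta> k) * inner_wrt M (r k) (r k)" for k
    using \<mu> \<delta>[of k] \<theta>[of k] inner_wrt_nonneg[OF M] by (intro mult_nonneg_nonneg) auto

  have rate: "(norm_wrt M ((1 / \<gamma>) *\<^sub>R (p (int n) - y (int n))))\<^sup>2
      \<le> 2 * (norm_wrt M (y 0 - x))\<^sup>2
        / (\<gamma>\<^sup>2 * (4 - \<gamma> * \<beta>' - 2 * l 0) * l 0 * (1 + real n) powr (2 * e))"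
    if x: "x \<in> zeros (add_operator C A)" for x n
  proof -
    define g where "g = inner_wrt M (G (Y n)) (G (Y n))"
    have Gx: "G x = 0" using x zero_iff by simp
    have "\<mu> * (1 - \<mu>) * (\<theta> n)\<^sup>2 * (4 * \<kappa>\<^sup>2 * g) \<le> inner_wrt M (y 0 - x) (y 0 - x)"
    proof -
      have "0 \<le> (\<Sum>k<n. \<mu> * (1 - \<mu>) * \<delta> k * (2 * \<theta> k - \<delta> k) * inner_wrt M (r k) (r k))"
        by (intro sum_nonneg sum_terms_nonneg)
      then show ?thesis
        using energy_ge[OF Gx, of n] energy[OF Gx, of n] by (simp only: g_def flip: r_sq)
    qed
    moreover have "\<mu> * (1 - \<mu>) * (4 * \<kappa>\<^sup>2) = l 0 * (2 * \<kappa> - l 0)"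
      using \<kappa>(3) by (simp add: \<mu>_def field_simps power2_eq_square)
    moreover have "(\<theta> n)\<^sup>2 = (1 + real n) powr (2 * e)"
      by (simp add: \<theta>_def power2_eq_square flip: powr_add)
    ultimately have bound: "(l 0 * (2 * \<kappa> - l 0)) * (1 + real n) powr (2 * e) * g
        \<le> inner_wrt M (y 0 - x) (y 0 - x)"
      by (metis (no_types, opaque_lifting) mult.assoc mult.commute)
    define T where "T = (1 + real n) powr (2 * e)"
    have "0 < T" by (simp add: T_def)
    have fac: "4 - \<gamma> * \<beta>' - 2 * l 0 = 2 * (2 * \<kappa> - l 0)" by (simp add: \<kappa>_def)
    have "(norm_wrt M ((1 / \<gamma>) *\<^sub>R (p (int n) - y (int n))))\<^sup>2 = g / \<gamma>\<^sup>2"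
      unfolding norm_wrt_square[OF M] by (simp add: p Ms g_def power2_eq_square flip: Y_def)
    also have "g \<le> inner_wrt M (y 0 - x) (y 0 - x) / (l 0 * (2 * \<kappa> - l 0) * T)"
      using bound[folded T_def] \<kappa> \<open>0 < T\<close> by (simp add: pos_le_divide_eq mult_ac)
    then have "g / \<gamma>\<^sup>2 \<le> inner_wrt M (y 0 - x) (y 0 - x) / (l 0 * (2 * \<kappa> - l 0) * T) / \<gamma>\<^sup>2"
      by (rule divide_right_mono) simp
    also have "\<dots> = 2 * (norm_wrt M (y 0 - x))\<^sup>2 / (\<gamma>\<^sup>2 * (2 * (2 * \<kappa> - l 0)) * l 0 * T)"
      using \<kappa> \<gamma> \<open>0 < T\<close> by (simp add: norm_wrt_square[OF M] field_simps)
    finally show ?thesis unfolding fac T_def .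
  qed

  obtain x0 where x0: "G x0 = 0" using assms(5) zero_iff by blast
  have summable: "summable (\<lambda>n. (norm (p (int n) - y (int n)))\<^sup>2)" if "e < 1"
  proof -
    obtain c where c: "c > 0" "\<And>x. c * (norm x)\<^sup>2 \<le> inner_wrt M x x"
      using inner_wrt_ge[OF M] by blast
    define K where "K = \<mu> * (1 - \<mu>) * (1 - e) * (4 * \<kappa>\<^sup>2) * c"
    have K: "K > 0" using \<mu> \<kappa> c(1) that by (simp add: K_def)
    have summand: "K * (norm (p (int k) - y (int k)))\<^sup>2
        \<le> \<mu> * (1 - \<mu>) * \<delta> k * (2 * \<theta> k - \<delta> k) * inner_wrt M (r k) (r k)" for k
    proof -
      define g where "g = inner_wrt M (G (Y k)) (G (Y k))"
      have "norm (p (int k) - y (int k)) = norm (G (Y k))" by (simp add: p flip: Y_def)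
      then have "K * (norm (p (int k) - y (int k)))\<^sup>2
          = (\<mu> * (1 - \<mu>) * (4 * \<kappa>\<^sup>2)) * ((1 - e) * 1) * (c * (norm (G (Y k)))\<^sup>2)"
        by (simp add: K_def)
      also have "\<dots> \<le> (\<mu> * (1 - \<mu>) * (4 * \<kappa>\<^sup>2)) * (\<delta> k * (2 * \<theta> k - \<delta> k)) * g"
        using \<mu> \<delta>[of k] \<theta>[of k] c that
        by (intro mult_mono mult_nonneg_nonneg) (auto simp: g_def)
      finally show ?thesis by (simp add: r_sq g_def mult_ac)
    qed
    have "(\<Sum>k<n. (norm (p (int k) - y (int k)))\<^sup>2) \<le> inner_wrt M (y 0 - x0) (y 0 - x0) / K" for n
    proof -
      have "0 \<le> \<mu> * (1 - \<mu>) * (\<theta> n)\<^sup>2 * inner_wrt M (r n) (r n)"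
        using \<mu> inner_wrt_nonneg[OF M] by (intro mult_nonneg_nonneg) auto
      then have "(\<Sum>k<n. \<mu> * (1 - \<mu>) * \<delta> k * (2 * \<theta> k - \<delta> k) * inner_wrt M (r k) (r k))
          \<le> inner_wrt M (y 0 - x0) (y 0 - x0)"
        using energy[OF x0, of n] energy_ge[OF x0, of n] by linarith
      moreover have "K * (\<Sum>k<n. (norm (p (int k) - y (int k)))\<^sup>2)
          \<le> (\<Sum>k<n. \<mu> * (1 - \<mu>) * \<delta> k * (2 * \<theta> k - \<delta> k) * inner_wrt M (r k) (r k))"
        unfolding sum_distrib_left by (intro sum_mono summand)
      ultimately show ?thesis using K by (simp add: pos_le_divide_eq mult.commute)
    qed
    then show ?thesis by (intro summableI_nonneg_bounded) auto
  qed

  have unaccelerated: "(\<forall>n::nat. y (int n + 1) = p (int n)) \<and>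
      (\<exists>x\<in>zeros (add_operator C A). weakly_converges (\<lambda>n. p (int n)) x)" if "e = 0"
  proof -
    have l1: "l n = 1" for n using assms(11) \<kappa>(3) that l[of n] by (simp add: \<theta>_def \<kappa>_def)
    have yp: "y (int n + 1) = p (int n)" for n using assms(19)[of n] by (simp add: l1)
    define T where "T u = u - G u" for u
    have step: "Y (Suc n) = T (Y n)" for n
      using yp[of n] p[of n] by (simp add: T_def Y_def add.commute)
    \<comment> \<open>Here \<open>l 0 = 1\<close>, so that \<open>l 0 < 2 \<kappa>\<close> makes \<open>G\<close> cocoercive with modulus above one half.\<close>
    have nonexp: "inner_wrt M (T u - T v) (T u - T v) \<le> inner_wrt M (u - v) (u - v)" for u v
    proof -
      define d where "d = G u - G v"
      have "T u - T v = (u - v) - d" by (simp add: T_def d_def)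
      then have "inner_wrt M (T u - T v) (T u - T v)
          = inner_wrt M (u - v) (u - v) - 2 * inner_wrt M d (u - v) + inner_wrt M d d"
        by (simp add: Ms inner_wrt_commute[OF M, of u d] inner_wrt_commute[OF M, of v d])
      moreover have "inner_wrt M d d \<le> 2 * \<kappa> * inner_wrt M d d"
        using \<kappa>(2) l1[of 0] inner_wrt_nonneg[OF M, of d] mult_right_mono[of 1 "2 * \<kappa>"] by fastforce
      ultimately show ?thesis using G[of u v] by (simp flip: d_def)
    qed
    have "(\<lambda>n. (norm (p (int n) - y (int n)))\<^sup>2) \<longlonglongrightarrow> 0"
      using summable that by (intro summable_LIMSEQ_zero) simp
    then have "(\<lambda>n. norm (p (int n) - y (int n))) \<longlonglongrightarrow> 0"
      using tendsto_real_sqrt by fastforce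
    moreover have "Y (Suc n) - Y n = p (int n) - y (int n)" for n
      using yp[of n] by (simp add: Y_def add.commute)
    ultimately have "(\<lambda>n. Y (Suc n) - Y n) \<longlonglongrightarrow> 0" by (simp add: tendsto_norm_zero_iff)
    moreover have "T x0 = x0" using x0 by (simp add: T_def)
    ultimately obtain q where q: "T q = q" "weakly_converges Y q"
      using opial_picard[of M T x0 Y, OF M nonexp _ step] by blast
    have p_eq: "p (int n) = Y (Suc n)" for n using yp by (simp add: Y_def add.commute)
    have "(\<lambda>n. inner (Y (Suc n)) u) \<longlonglongrightarrow> inner q u" for u
      using q(2) LIMSEQ_Suc[of "\<lambda>n. inner (Y n) u"] by (simp add: weakly_converges_def)
    then have "weakly_converges (\<lambda>n. p (int n)) q" by (simp add: weakly_converges_def p_eq)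
    moreover have "q \<in> zeros (add_operator C A)" using q(1) zero_iff[of q] by (simp add: T_def)
    ultimately show ?thesis using yp by blast
  qed
  show ?thesis
    by (intro conjI impI ballI allI) (use rate summable unaccelerated assms(18) in simp_all)
qed

end
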